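(* Let $\alpha>0$ and let $\mathcal F$ be a max-linear sub-space of $L_+^\alpha(S_1,\mu_1)$ with $\mathrm{supp}(\mathcal F)=S_1$. If $\mu_1$ is $\sigma$-finite and $U:\mathcal F\to L_+^\alpha(S_2,\mu_2)$ is a max-linear isometry, then: (i) $U$ has a unique extension to a max-linear isometry $\overline U$, defined on $\mathcal R_{e,+}(\mathcal F)$ with values in $L_+^\alpha(S_2,\mu_2)$. Moreover, $\overline U$ is onto $\mathcal R_{e,+}(U(\mathcal F))\subset L_+^\alpha(S_2,\mu_2)$, and $$\overline U(rf)=(Tr)\,(Uf)\quad\text{for all } r\in\mathcal R_+(\mathcal F),\ f\in\mathcal F,$$ where the function mapping $T:\mathcal R_+(\mathcal F)\to\mathcal R_+(U(\mathcal F))$ is induced by a regular set isomorphism of $\rho(\mathcal F)$ onto $\rho(U(\mathcal F))$. (ii) For all $f\in\mathcal F$, $$(Uf)^\alpha\,d\mu_2=d\mu_{1,f}\circ T^{-1},$$ where $d\mu_{1,f}=f^\alpha d\mu_1$. This equality means that the two measures coincide on the $\sigma$-field $\rho(U(\mathcal F))$, i.e. $\int_A (Uf)^\alpha d\mu_2=\mu_{1,f}\circ T^{-1}(A)$ for all $A\in\rho(U(\mathcal F))$.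
   Context: $(S_1,\mu_1)$ and $(S_2,\mu_2)$ are measure spaces. For a measure space $(S,\mu)$, $L_+^\alpha(S,\mu)$ is the set of measurable $f:S\to[0,\infty)$ with $\int_S f^\alpha d\mu<\infty$, with metric $\rho_{\mu,\alpha}(f,g)=\int_S|f^\alpha-g^\alpha|d\mu$ and $\|f\|^\alpha_{L^\alpha_+(\mu)}=\int_S f^\alpha d\mu$. A max-linear sub-space $\mathcal F\subset L_+^\alpha(S,\mu)$ is a subset closed in $\rho_{\mu,\alpha}$ with $af\vee bg\in\mathcal F$ for all $a,b>0$, $f,g\in\mathcal F$. A max-linear isometry $U$ from a set of functions in $L_+^\alpha(S_1,\mu_1)$ to $L_+^\alpha(S_2,\mu_2)$ is a map with $U(a_1f_1\vee a_2f_2)=a_1(Uf_1)\vee a_2(Uf_2)$ $\mu_2$-a.e. for all $f_1,f_2$ in the domain and $a_1,a_2\ge0$, and $\|Uf\|_{L^\alpha_+(\mu_2)}=\|f\|_{L^\alpha_+(\mu_1)}$ for all $f$ in the domain. For a collection $F\subset L_+^\alpha(S,\mu)$: the ratio $\sigma$-field is $\rho(F)=\sigma(\{f_1/f_2: f_1,f_2\in F\})$, where the ratios take values in $[0,\infty]$. The positive ratio space is $\mathcal R_+(F)=L_+^\alpha(S,\rho(F),\mu)$, the $\rho(F)$-measurable functions in $L_+^\alpha(S,\mu)$. The extended positive ratio space $\mathcal R_{e,+}(F)$ is the class of all functions in $L_+^\alpha(S,\mu)$ of the form $rf$ with $r$ non-negative $\rho(F)$-measurable and $f\in F$. With $\mathrm{supp}(f)=\{f\ne0\}$,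 a measurable function $f_0$ has full support w.r.t. $F$ if $\mu(\mathrm{supp}(g)\setminus\mathrm{supp}(f_0))=0$ for all $g\in F$; if in addition $f_0\in F$, one writes $\mathrm{supp}(F)=\mathrm{supp}(f_0)$ (defined modulo $\mu$-null sets). A regular set isomorphism between measure spaces $(S_1,\mathcal S_1,\mu_1)$ and $(S_2,\mathcal S_2,\mu_2)$ is a set map $T:\mathcal S_1\to\mathcal S_2$, defined modulo null sets, with: $T(S_1\setminus A)=T(S_1)\setminus T(A)$ mod $\mu_2$ for all $A\in\mathcal S_1$; $T(\bigcup_n A_n)=\bigcup_nT(A_n)$ mod $\mu_2$ for disjoint $A_n\in\mathcal S_1$; $\mu_2(T(A))=0$ if and only if $\mu_1(A)=0$. It induces a canonical map $f\mapsto Tf$ on measurable functions such that $\{Tf\in B\}=T\{f\in B\}$ mod $\mu_2$ for all Borel sets $B\subset\mathbb R$. Sets that are equal modulo null sets are identified.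
   Formalization: T maps nonnegative ρ(F)-measurable functions to nonnegative ρ(U(F))-measurable ones (Tr need not lie in L^α_+, so the printed R_+(U(F)) fails); the formula is for rf in L^α_+, where Ū(rf) is defined; "onto ρ(U(F))" is meant on supp(U(F)) = T(S_1). *)

theory Defs
  imports "HOL-Analysis.Analysis" "HOL-Probability.Conditional_Expectation"
begin

text \<open>
  Functions are kept as honest functions rather than classes modulo null sets; every
  identification modulo null sets is written out as an \<open>AE\<close> statement.
\<close>

definition Lplus :: "real \<Rightarrow> 'a measure \<Rightarrow> ('a \<Rightarrow> real) set" where
  "Lplus \<alpha> M = {f \<in> borel_measurable M.
     (\<forall>x\<in>space M. 0 \<le> f x) \<and> (\<integral>\<^sup>+ x. ennreal (f x powr \<alpha>) \<partial>M) < \<infinity>}"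

definition Lplus_dist :: "real \<Rightarrow> 'a measure \<Rightarrow> ('a \<Rightarrow> real) \<Rightarrow> ('a \<Rightarrow> real) \<Rightarrow> real" where
  "Lplus_dist \<alpha> M f g = (\<integral> x. \<bar>f x powr \<alpha> - g x powr \<alpha>\<bar> \<partial>M)"

definition Lplus_norm :: "real \<Rightarrow> 'a measure \<Rightarrow> ('a \<Rightarrow> real) \<Rightarrow> real" where
  "Lplus_norm \<alpha> M f = (\<integral> x. f x powr \<alpha> \<partial>M) powr (1 / \<alpha>)"

text \<open>
  Closedness is with respect to the pseudo-metric \<^const>\<open>Lplus_dist\<close>; in particular a max-linear
  subspace contains with \<open>f\<close> every \<open>g \<in> Lplus \<alpha> M\<close> that agrees with \<open>f\<close> almost everywhere.
\<close>

definition max_linear_subspace :: "real \<Rightarrow> 'a measure \<Rightarrow> ('a \<Rightarrow> real) set \<Rightarrow> bool" where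
  "max_linear_subspace \<alpha> M F \<longleftrightarrow>
     F \<subseteq> Lplus \<alpha> M \<and>
     (\<forall>f\<in>Lplus \<alpha> M. (\<forall>e>0. \<exists>g\<in>F. Lplus_dist \<alpha> M f g < e) \<longrightarrow> f \<in> F) \<and>
     (\<forall>f\<in>F. \<forall>g\<in>F. \<forall>a>0. \<forall>b>0. (\<lambda>x. max (a * f x) (b * g x)) \<in> F)"

definition max_linear_isometry ::
  "real \<Rightarrow> 'a measure \<Rightarrow> 'b measure \<Rightarrow> ('a \<Rightarrow> real) set \<Rightarrow> (('a \<Rightarrow> real) \<Rightarrow> 'b \<Rightarrow> real) \<Rightarrow> bool" where
  "max_linear_isometry \<alpha> M N D U \<longleftrightarrow>
     (\<forall>f\<in>D. U f \<in> Lplus \<alpha> N) \<and>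
     (\<forall>f\<in>D. \<forall>g\<in>D. \<forall>a\<ge>0. \<forall>b\<ge>0.
        AE x in N. U (\<lambda>y. max (a * f y) (b * g y)) x = max (a * U f x) (b * U g x)) \<and>
     (\<forall>f\<in>D. Lplus_norm \<alpha> N (U f) = Lplus_norm \<alpha> M f)"

text \<open>
  The ratios are taken in \<^typ>\<open>ennreal\<close>, so \<open>c / 0 = \<infinity>\<close> for \<open>c > 0\<close> and \<open>0 / 0 = 0\<close>.
  Hence the support of every \<open>f \<in> F\<close> belongs to the ratio field, being \<open>{x. f x / f x = 1}\<close>.
\<close>

definition ratio_field :: "'a measure \<Rightarrow> ('a \<Rightarrow> real) set \<Rightarrow> 'a measure" where
  "ratio_field M F = sigma (space M)
     {(\<lambda>x. ennreal (f x) / ennreal (g x)) -` B \<inter> space M | f g B. f \<in> F \<and> g \<in> F \<and> B \<in> sets borel}"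

text \<open>The measure space \<open>(S, \<rho>(F), \<mu>)\<close>.\<close>

definition ratio_measure :: "'a measure \<Rightarrow> ('a \<Rightarrow> real) set \<Rightarrow> 'a measure" where
  "ratio_measure M F = restr_to_subalg M (ratio_field M F)"

definition ratio_functions :: "'a measure \<Rightarrow> ('a \<Rightarrow> real) set \<Rightarrow> ('a \<Rightarrow> real) set" where
  "ratio_functions M F = {r \<in> borel_measurable (ratio_field M F). \<forall>x\<in>space M. 0 \<le> r x}"

definition positive_ratio_space :: "real \<Rightarrow> 'a measure \<Rightarrow> ('a \<Rightarrow> real) set \<Rightarrow> ('a \<Rightarrow> real) set" where
  "positive_ratio_space \<alpha> M F = Lplus \<alpha> (ratio_measure M F)"

definition extended_positive_ratio_space ::
  "real \<Rightarrow> 'a measure \<Rightarrow> ('a \<Rightarrow> real) set \<Rightarrow> ('a \<Rightarrow> real) set" where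
  "extended_positive_ratio_space \<alpha> M F =
     {h \<in> Lplus \<alpha> M. \<exists>r\<in>ratio_functions M F. \<exists>f\<in>F. \<forall>x\<in>space M. h x = r x * f x}"

definition fun_supp :: "'a measure \<Rightarrow> ('a \<Rightarrow> real) \<Rightarrow> 'a set" where
  "fun_supp M f = {x \<in> space M. f x \<noteq> 0}"

definition full_support :: "'a measure \<Rightarrow> ('a \<Rightarrow> real) set \<Rightarrow> ('a \<Rightarrow> real) \<Rightarrow> bool" where
  "full_support M F f0 \<longleftrightarrow> f0 \<in> borel_measurable M \<and>
     (\<forall>g\<in>F. emeasure M (fun_supp M g - fun_supp M f0) = 0)"

definition eq_mod_null :: "'a measure \<Rightarrow> 'a set \<Rightarrow> 'a set \<Rightarrow> bool" where
  "eq_mod_null M A B \<longleftrightarrow> (AE x in M. x \<in> A \<longleftrightarrow> x \<in> B)"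

text \<open>\<open>is_supp M F S\<close> is the relation \<open>supp(F) = S\<close>, which only makes sense modulo null sets.\<close>

definition is_supp :: "'a measure \<Rightarrow> ('a \<Rightarrow> real) set \<Rightarrow> 'a set \<Rightarrow> bool" where
  "is_supp M F S \<longleftrightarrow> (\<exists>f0\<in>F. full_support M F f0 \<and> eq_mod_null M (fun_supp M f0) S)"

text \<open>As usual, \<open>T (space M)\<close> need not be all of \<open>space N\<close>.\<close>

definition regular_set_isomorphism ::
  "'a measure \<Rightarrow> 'b measure \<Rightarrow> ('a set \<Rightarrow> 'b set) \<Rightarrow> bool" where
  "regular_set_isomorphism M N T \<longleftrightarrow>
     (\<forall>A\<in>sets M. T A \<in> sets N) \<and>
     (\<forall>A\<in>sets M. eq_mod_null N (T (space M - A)) (T (space M) - T A)) \<and>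
     (\<forall>A :: nat \<Rightarrow> 'a set. range A \<subseteq> sets M \<longrightarrow> disjoint_family A \<longrightarrow>
        eq_mod_null N (T (\<Union>n. A n)) (\<Union>n. T (A n))) \<and>
     (\<forall>A\<in>sets M. emeasure N (T A) = 0 \<longleftrightarrow> emeasure M A = 0)"

text \<open>
  The canonical map on functions induced by \<open>T\<close>. The image of a function naturally lives on
  \<open>T (space M)\<close>; it is extended by \<open>0\<close> to the rest of \<open>space N\<close>.
\<close>

definition induces_function_map ::
  "'a measure \<Rightarrow> 'b measure \<Rightarrow> ('a set \<Rightarrow> 'b set) \<Rightarrow> (('a \<Rightarrow> real) \<Rightarrow> 'b \<Rightarrow> real) \<Rightarrow> bool" where
  "induces_function_map M N T Tf \<longleftrightarrow>
     (\<forall>f\<in>borel_measurable M.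
        Tf f \<in> borel_measurable N \<and>
        (\<forall>B\<in>sets borel.
           eq_mod_null N (Tf f -` B \<inter> T (space M)) (T (f -` B \<inter> space M))) \<and>
        (AE x in N. x \<notin> T (space M) \<longrightarrow> Tf f x = 0))"

lemma subalgebra_ratio_field:
  assumes "F \<subseteq> Lplus \<alpha> M"
  shows "subalgebra M (ratio_field M F)"
proof -
  have "(\<lambda>x. ennreal (f x) / ennreal (g x)) -` B \<inter> space M \<in> sets M"
    if "f \<in> F" "g \<in> F" "B \<in> sets borel" for f g B
  proof -
    have "f \<in> borel_measurable M" "g \<in> borel_measurable M"
      using that assms by (auto simp: Lplus_def)
    then show ?thesis using that(3) by measurable
  qed
  then have gen: "{(\<lambda>x. ennreal (f x) / ennreal (g x)) -` B \<inter> space M | f g B.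
      f \<in> F \<and> g \<in> F \<and> B \<in> sets borel} \<subseteq> sets M" (is "?G \<subseteq> _")
    by blast
  then have "?G \<subseteq> Pow (space M)"
    using sets.space_closed by blast
  then have "sets (ratio_field M F) = sigma_sets (space M) ?G"
    unfolding ratio_field_def by (rule sets_measure_of)
  moreover have "sigma_sets (space M) ?G \<subseteq> sets M"
    using gen by (rule sets.sigma_sets_subset)
  moreover have "space (ratio_field M F) = space M"
    unfolding ratio_field_def by (rule space_measure_of_conv)
  ultimately show ?thesis
    by (simp add: subalgebra_def)
qed

text \<open>
  Statements about all \<^const>\<open>ratio_functions\<close> cover in particular the positive ratio space.
\<close>

lemma positive_ratio_space_subset_ratio_functions:
  assumes "F \<subseteq> Lplus \<alpha> M"
  shows "positive_ratio_space \<alpha> M F \<subseteq> ratio_functions M F"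
proof -
  have "sets (ratio_measure M F) = sets (ratio_field M F)"
    unfolding ratio_measure_def
    by (rule sets_restr_to_subalg[OF subalgebra_ratio_field[OF assms]])
  then have "borel_measurable (ratio_measure M F) =
      (borel_measurable (ratio_field M F) :: ('a \<Rightarrow> real) set)"
    by (rule measurable_cong_sets) (rule refl)
  moreover have "space (ratio_measure M F) = space M"
    unfolding ratio_measure_def by (rule space_restr_to_subalg)
  ultimately show ?thesis
    by (auto simp: positive_ratio_space_def Lplus_def ratio_functions_def)
qed

end

theory Submission
  imports Defs
begin

text \<open>
  Fix \<open>f0 \<in> F\<close> that is nonzero almost everywhere and send a point \<open>x\<close> to the family of ratios
  \<open>\<Phi>1 x = (f x / f0 x)\<close>, \<open>f \<in> F\<close>, in the product space \<open>P = \<real>\<^sup>F\<close>. On the target side let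
  \<open>\<Phi>2 y = (U f y / U f0 y)\<close>, \<open>f \<in> F\<close>. The heart of the proof is that \<open>\<Phi>1\<close> and \<open>\<Phi>2\<close> have the
  same law, the first under \<open>f0\<^sup>\<alpha> d\<mu>1\<close> and the second under \<open>(U f0)\<^sup>\<alpha> d\<mu>2\<close>
  (\<open>ratio_map_distr_eq\<close>). Indeed, for \<open>k \<in> F\<close> the function
  \<open>c \<mapsto> \<integral> (c f0 \<or> k)\<^sup>\<alpha> d\<mu>1\<close> is determined by the norms of elements of \<open>F\<close>, hence does not change
  under \<open>U\<close>. Its right derivative in \<open>c\<^sup>\<alpha>\<close> at \<open>c = 1\<close> is the integral of \<open>f0\<^sup>\<alpha>\<close> over
  \<open>{k \<le> f0}\<close> (\<open>right_derivative_integral_max\<close>). Choosing for \<open>k\<close> a maximum of finitely many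
  \<open>f / a\<^sub>f\<close> turns \<open>{k \<le> f0}\<close> into the event that finitely many coordinates of \<open>\<Phi>1\<close> are bounded by
  the constants \<open>a\<^sub>f\<close>, and such events determine a law on the nonnegative part of \<open>P\<close>.

  Everything else is read off from this equality of laws. Up to the null set where \<open>f0\<close> vanishes, the
  ratio field \<open>\<rho>(F)\<close> consists of the preimages \<open>\<Phi>1 -` C\<close>, and its measurable functions are the
  compositions \<open>g \<circ> \<Phi>1\<close>; on \<open>{U f0 \<noteq> 0}\<close> the same holds for \<open>\<rho>(U(F))\<close> and \<open>\<Phi>2\<close>
  (\<open>ratio_field_set_factorization\<close>, \<open>ratio_field_function_factorization\<close>). The set
  isomorphism is \<open>\<Phi>1 -` C \<mapsto> \<Phi>2 -` C \<inter> {U f0 \<noteq> 0}\<close>, the function map is \<open>g \<circ> \<Phi>1 \<mapsto> g \<circ> \<Phi>2\<close>, and the extended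
  isometry is \<open>(g \<circ> \<Phi>1) f0 \<mapsto> (g \<circ> \<Phi>2) U f0\<close>. They are well defined modulo null sets because almost
  sure properties of \<open>\<Phi>1\<close> and \<open>\<Phi>2\<close> correspond to each other (\<open>AE_transfer\<close>).

  Uniqueness comes from applying the same equality of laws a second time, to a competing extension \<open>V\<close> on the
  extended ratio space, which is itself closed under maxima. The relation \<open>h / f0 = g \<circ> \<Phi>1\<close> is a
  property of the joint law of \<open>h / f0\<close> and \<open>\<Phi>1\<close>, so \<open>V h / U f0 = g \<circ> \<Phi>2\<close> is forced
  on \<open>{U f0 \<noteq> 0}\<close>; elsewhere \<open>V h\<close> vanishes.
\<close>

section \<open>The cones of functions with integrable power\<close>

lemma LplusD:
  assumes "f \<in> Lplus \<alpha> M"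
  shows "f \<in> borel_measurable M" "\<And>x. x \<in> space M \<Longrightarrow> 0 \<le> f x"
    "(\<integral>\<^sup>+ x. ennreal (f x powr \<alpha>) \<partial>M) < \<infinity>" "integrable M (\<lambda>x. f x powr \<alpha>)"
proof -
  show m: "f \<in> borel_measurable M" "\<And>x. x \<in> space M \<Longrightarrow> 0 \<le> f x"
    and fin: "(\<integral>\<^sup>+ x. ennreal (f x powr \<alpha>) \<partial>M) < \<infinity>"
    using assms by (auto simp: Lplus_def)
  show "integrable M (\<lambda>x. f x powr \<alpha>)"
    using m(1) fin by (intro integrableI_nonneg) auto
qed

lemma powr_max:
  fixes a b p :: real
  assumes "0 \<le> a" "0 \<le> b" "0 < p"
  shows "max a b powr p = max (a powr p) (b powr p)"
  using assms powr_mono2[of p a b] powr_mono2[of p b a] by (auto simp: max_def)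

lemma Lplus_norm_eq_iff:
  assumes "0 < \<alpha>" "f \<in> Lplus \<alpha> M" "g \<in> Lplus \<alpha> N"
  shows "Lplus_norm \<alpha> M f = Lplus_norm \<alpha> N g \<longleftrightarrow>
    (\<integral>\<^sup>+ x. ennreal (f x powr \<alpha>) \<partial>M) = (\<integral>\<^sup>+ x. ennreal (g x powr \<alpha>) \<partial>N)"
proof -
  have "Lplus_norm \<alpha> M f = Lplus_norm \<alpha> N g \<longleftrightarrow>
     (\<integral> x. f x powr \<alpha> \<partial>M) = (\<integral> x. g x powr \<alpha> \<partial>N)"
  proof
    assume "Lplus_norm \<alpha> M f = Lplus_norm \<alpha> N g"
    then have "Lplus_norm \<alpha> M f powr \<alpha> = Lplus_norm \<alpha> N g powr \<alpha>"
      by simp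
    then show "(\<integral> x. f x powr \<alpha> \<partial>M) = (\<integral> x. g x powr \<alpha> \<partial>N)"
      using assms(1) by (simp add: Lplus_norm_def powr_powr)
  qed (simp add: Lplus_norm_def)
  also have "\<dots> \<longleftrightarrow> (\<integral>\<^sup>+ x. ennreal (f x powr \<alpha>) \<partial>M) = (\<integral>\<^sup>+ x. ennreal (g x powr \<alpha>) \<partial>N)"
    using LplusD(4)[OF assms(2)] LplusD(4)[OF assms(3)] by (simp add: nn_integral_eq_integral)
  finally show ?thesis .
qed

text \<open>
  Isometries are only meant modulo null sets. Changing one on each function separately by a null set
  is harmless, although the exceptional sets may depend on the function.
\<close>
lemma max_linear_isometry_cong_AE:
  assumes V: "max_linear_isometry \<alpha> M N D V" and VW: "\<And>f. f \<in> D \<Longrightarrow> AE x in N. V f x = W f x"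
    and W: "\<And>f. f \<in> D \<Longrightarrow> W f \<in> Lplus \<alpha> N"
    and D: "\<And>f g a b. f \<in> D \<Longrightarrow> g \<in> D \<Longrightarrow> 0 \<le> a \<Longrightarrow> 0 \<le> b \<Longrightarrow> (\<lambda>x. max (a * f x) (b * g x)) \<in> D"
  shows "max_linear_isometry \<alpha> M N D W"
  unfolding max_linear_isometry_def
proof (intro conjI ballI allI impI)
  fix f assume f: "f \<in> D"
  show "W f \<in> Lplus \<alpha> N" by (rule W[OF f])
  have "V f \<in> Lplus \<alpha> N" using V f by (simp add: max_linear_isometry_def)
  then have "(\<integral> x. W f x powr \<alpha> \<partial>N) = (\<integral> x. V f x powr \<alpha> \<partial>N)"
    using VW[OF f] LplusD(1)[OF W[OF f]] LplusD(1)[of "V f"]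
    by (intro integral_cong_AE) (auto elim: eventually_mono)
  then show "Lplus_norm \<alpha> N (W f) = Lplus_norm \<alpha> M f"
    using V f by (simp add: max_linear_isometry_def Lplus_norm_def)
next
  fix f g and a b :: real assume *: "f \<in> D" "g \<in> D" "0 \<le> a" "0 \<le> b"
  have "AE x in N. V (\<lambda>y. max (a * f y) (b * g y)) x = max (a * V f x) (b * V g x)"
    using V[unfolded max_linear_isometry_def] * by simp
  then show "AE x in N. W (\<lambda>y. max (a * f y) (b * g y)) x = max (a * W f x) (b * W g x)"
    using VW[OF *(1)] VW[OF *(2)] VW[OF D[OF *]] by eventually_elim simp
qed

text \<open>
  With \<open>p = f\<^sup>\<alpha>\<close> and \<open>q = k\<^sup>\<alpha>\<close> the left-hand side is a difference quotient of
  \<open>s \<mapsto> \<integral> max (s p) q\<close> at \<open>s = 1\<close> with step \<open>1 / (n + 1)\<close>. Under the integral it equals \<open>p\<close> where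
  \<open>q \<le> p\<close>, vanishes eventually where \<open>p < q\<close>, and lies between \<open>0\<close> and \<open>p\<close>, so dominated
  convergence applies. Only a right derivative selects the closed condition \<open>k \<le> f\<close>; where
  \<open>k = f > 0\<close> the left derivative of the integrand is \<open>0\<close>.
\<close>
lemma right_derivative_integral_max:
  assumes \<alpha>: "0 < \<alpha>" and f: "f \<in> Lplus \<alpha> M" and k: "k \<in> Lplus \<alpha> M"
  shows "(\<lambda>n. real (Suc n) * ((\<integral> x. max ((1 + 1 / real (Suc n)) powr (1 / \<alpha>) * f x) (k x) powr \<alpha> \<partial>M)
            - (\<integral> x. max (f x) (k x) powr \<alpha> \<partial>M)))
    \<longlonglongrightarrow> (\<integral> x. indicator {x. k x \<le> f x} x * f x powr \<alpha> \<partial>M)"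
proof -
  note [measurable] = LplusD(1)[OF f] LplusD(1)[OF k]
  define p q where "p x = f x powr \<alpha>" and "q x = k x powr \<alpha>" for x
  define s where "s n x = real (Suc n) * (max ((1 + 1 / real (Suc n)) * p x) (q x) - max (p x) (q x))"
    for n x
  have [measurable]: "p \<in> borel_measurable M" "q \<in> borel_measurable M"
    unfolding p_def q_def by measurable
  have int: "integrable M p" "integrable M q"
    unfolding p_def q_def using LplusD(4)[OF f] LplusD(4)[OF k] by auto
  have pq: "0 \<le> p x" "0 \<le> q x" for x
    by (auto simp: p_def q_def)
  have max1: "max ((1 + 1 / real (Suc n)) powr (1 / \<alpha>) * f x) (k x) powr \<alpha>
      = max ((1 + 1 / real (Suc n)) * p x) (q x)" if "x \<in> space M" for n x
  proof -
    have "0 \<le> f x" "0 \<le> k x"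
      using that LplusD(2)[OF f] LplusD(2)[OF k] by auto
    moreover have "((1 + 1 / real (Suc n)) powr (1 / \<alpha>) * f x) powr \<alpha> = (1 + 1 / real (Suc n)) * p x"
      using \<alpha> \<open>0 \<le> f x\<close> by (simp add: powr_mult powr_powr p_def)
    ultimately show ?thesis
      using \<alpha> by (simp add: powr_max q_def)
  qed
  have max0: "max (f x) (k x) powr \<alpha> = max (p x) (q x)" if "x \<in> space M" for x
    using that \<alpha> LplusD(2)[OF f] LplusD(2)[OF k] by (simp add: powr_max p_def q_def)
  have "real (Suc n) * ((\<integral> x. max ((1 + 1 / real (Suc n)) powr (1 / \<alpha>) * f x) (k x) powr \<alpha> \<partial>M)
            - (\<integral> x. max (f x) (k x) powr \<alpha> \<partial>M)) = (\<integral> x. s n x \<partial>M)" for n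
  proof -
    have "(\<integral> x. s n x \<partial>M) = real (Suc n) *
       ((\<integral> x. max ((1 + 1 / real (Suc n)) * p x) (q x) \<partial>M) - (\<integral> x. max (p x) (q x) \<partial>M))"
      unfolding s_def using int by (subst Bochner_Integration.integral_diff[symmetric]) auto
    moreover have "(\<integral> x. max ((1 + 1 / real (Suc n)) powr (1 / \<alpha>) * f x) (k x) powr \<alpha> \<partial>M)
      = (\<integral> x. max ((1 + 1 / real (Suc n)) * p x) (q x) \<partial>M)"
      by (rule Bochner_Integration.integral_cong) (simp_all only: max1)
    moreover have "(\<integral> x. max (f x) (k x) powr \<alpha> \<partial>M) = (\<integral> x. max (p x) (q x) \<partial>M)"
      by (rule Bochner_Integration.integral_cong) (simp_all only: max0)
    ultimately show ?thesis by simp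
  qed
  moreover have "(\<lambda>n. \<integral> x. s n x \<partial>M) \<longlonglongrightarrow> (\<integral> x. indicator {x. k x \<le> f x} x * f x powr \<alpha> \<partial>M)"
  proof (rule integral_dominated_convergence[where w = p])
    show "AE x in M. (\<lambda>n. s n x) \<longlonglongrightarrow> indicator {x. k x \<le> f x} x * f x powr \<alpha>"
    proof (rule AE_I2)
      fix x assume x: "x \<in> space M"
      then have nn: "0 \<le> f x" "0 \<le> k x"
        using LplusD(2)[OF f] LplusD(2)[OF k] by auto
      show "(\<lambda>n. s n x) \<longlonglongrightarrow> indicator {x. k x \<le> f x} x * f x powr \<alpha>"
      proof (cases "k x \<le> f x")
        case True
        then have "q x \<le> p x"
          unfolding p_def q_def using nn \<alpha> by (intro powr_mono2) auto
        then have "s n x = p x" for n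
        proof -
          have "q x \<le> (1 + 1 / real (Suc n)) * p x"
            using \<open>q x \<le> p x\<close> pq(1)[of x] by (simp add: distrib_right add_increasing2)
          then have "s n x = real (Suc n) * ((1 + 1 / real (Suc n)) * p x - p x)"
            using \<open>q x \<le> p x\<close> by (simp add: s_def max_def)
          also have "\<dots> = p x"
            by (simp add: field_simps)
          finally show ?thesis .
        qed
        then show ?thesis
          using True by (simp add: p_def)
      next
        case False
        then have lt: "p x < q x"
          unfolding p_def q_def using nn \<alpha> by (intro powr_less_mono2) auto
        have "(\<lambda>n. (1 + 1 / real (Suc n)) * p x) \<longlonglongrightarrow> (1 + 0) * p x"
          by (intro tendsto_intros LIMSEQ_Suc[OF lim_1_over_n])
        then have "eventually (\<lambda>n. (1 + 1 / real (Suc n)) * p x < q x) sequentially"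
          using lt by (intro order_tendstoD(2)) auto
        then have "eventually (\<lambda>n. s n x = 0) sequentially"
          by eventually_elim (use lt in \<open>simp add: s_def max_def\<close>)
        then show ?thesis
          using False by (auto intro: tendsto_eventually)
      qed
    qed
    show "AE x in M. norm (s n x) \<le> p x" for n
    proof (rule AE_I2)
      fix x
      have e: "real (Suc n) * ((1 + 1 / real (Suc n)) * p x - p x) = p x"
        by (simp add: field_simps)
      have le: "p x \<le> (1 + 1 / real (Suc n)) * p x"
        using pq(1)[of x] by (simp add: distrib_right)
      then have "0 \<le> max ((1 + 1 / real (Suc n)) * p x) (q x) - max (p x) (q x)"
        "max ((1 + 1 / real (Suc n)) * p x) (q x) - max (p x) (q x) \<le> (1 + 1 / real (Suc n)) * p x - p x"
        by (auto simp: max_def)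
      then have "0 \<le> s n x" "s n x \<le> real (Suc n) * ((1 + 1 / real (Suc n)) * p x - p x)"
        unfolding s_def by (auto intro!: mult_left_mono mult_nonneg_nonneg simp del: of_nat_Suc)
      then show "norm (s n x) \<le> p x"
        using e by simp
    qed
  qed (use int in \<open>auto simp: s_def\<close>)
  ultimately show ?thesis by simp
qed

section \<open>Laws on a product of real lines\<close>

lemma sets_lower_orthant:
  fixes a :: "'i \<Rightarrow> real"
  assumes "finite J" "J \<subseteq> I"
  shows "{z \<in> space (PiM I (\<lambda>_. borel)). \<forall>i\<in>J. z i \<le> a i} \<in> sets (PiM I (\<lambda>_. borel))"
proof (rule sets.sets_Collect_finite_All[OF _ assms(1)])
  fix i assume "i \<in> J"
  then have [measurable]: "i \<in> I" using assms by auto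
  show "{z \<in> space (PiM I (\<lambda>_. borel)). z i \<le> a i} \<in> sets (PiM I (\<lambda>_. borel))"
    by measurable
qed

text \<open>
  Cylinders given by finitely many upper bounds are stable under intersection, and already those
  with a single bound generate the product \<open>\<sigma>\<close>-field. The index set may be uncountable.
\<close>
lemma PiM_measure_eqI_lower_orthants:
  fixes P Q :: "('i \<Rightarrow> real) measure"
  assumes P: "sets P = sets (PiM I (\<lambda>_. borel))" and Q: "sets Q = sets (PiM I (\<lambda>_. borel))"
    and fin: "emeasure P (space P) \<noteq> \<infinity>"
    and eq: "\<And>J a. finite J \<Longrightarrow> J \<subseteq> I \<Longrightarrow>
      emeasure P {z \<in> space (PiM I (\<lambda>_. borel)). \<forall>i\<in>J. z i \<le> a i} =
      emeasure Q {z \<in> space (PiM I (\<lambda>_. borel)). \<forall>i\<in>J. z i \<le> a i}"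
  shows "P = Q"
proof -
  let ?S = "space (PiM I (\<lambda>_. borel :: real measure))"
  define E where "E = {{z \<in> ?S. \<forall>i\<in>J. z i \<le> a i} | J a. finite J \<and> J \<subseteq> I}"
  have spE: "{z \<in> ?S. \<forall>i\<in>J. z i \<le> a i} \<in> E" if "finite J" "J \<subseteq> I" for J a
    using that by (auto simp: E_def)
  have gen: "sets (PiM I (\<lambda>_. borel :: real measure)) = sigma_sets ?S E"
  proof
    show "sets (PiM I (\<lambda>_. borel)) \<subseteq> sigma_sets ?S E"
    proof -
      have "{f \<in> Pi\<^sub>E I (\<lambda>_. UNIV). f i \<in> A} \<in> sigma_sets ?S E"
        if i: "i \<in> I" and A: "A \<in> sets (borel :: real measure)" for i A
      proof -
        have "sets (vimage_algebra ?S (\<lambda>z. z i) borel) = sigma_sets ?S {(\<lambda>z. z i) -` X \<inter> ?S | X. X \<in> range atMost}"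
          by (subst borel_eq_atMost, subst vimage_algebra_sigma) (auto simp: space_PiM intro!: sets_measure_of)
        moreover have "{(\<lambda>z. z i) -` X \<inter> ?S | X. X \<in> range atMost} \<subseteq> E"
        proof safe
          fix b :: real
          have "(\<lambda>z. z i) -` {..b} \<inter> ?S = {z \<in> ?S. \<forall>j\<in>{i}. z j \<le> b}" by auto
          then show "(\<lambda>z. z i) -` {..b} \<inter> ?S \<in> E"
            using spE[of "{i}" "\<lambda>_. b"] i by simp
        qed
        ultimately have "sets (vimage_algebra ?S (\<lambda>z. z i) borel) \<subseteq> sigma_sets ?S E"
          by (simp add: sigma_sets_mono')
        moreover have "(\<lambda>z. z i) -` A \<inter> ?S \<in> sets (vimage_algebra ?S (\<lambda>z. z i) borel)"
          using A by (rule in_vimage_algebra)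
        moreover have "(\<lambda>z. z i) -` A \<inter> ?S = {f \<in> Pi\<^sub>E I (\<lambda>_. UNIV). f i \<in> A}"
          by (auto simp: space_PiM)
        ultimately show ?thesis by auto
      qed
      then have "{{f \<in> Pi\<^sub>E I (\<lambda>_. UNIV). f i \<in> A} | i A. i \<in> I \<and> A \<in> sets (borel :: real measure)}
          \<subseteq> sigma_sets ?S E"
        by blast
      then show ?thesis
        by (simp add: sets_PiM_single space_PiM sigma_sets_mono)
    qed
    show "sigma_sets ?S E \<subseteq> sets (PiM I (\<lambda>_. borel))"
    proof (rule sets.sigma_sets_subset)
      show "E \<subseteq> sets (PiM I (\<lambda>_. borel))"
        unfolding E_def using sets_lower_orthant by blast
    qed
  qed
  show ?thesis
  proof (rule measure_eqI_generator_eq[where E = E and \<Omega> = ?S and A = "\<lambda>_. ?S"])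
    show "Int_stable E"
    proof (rule Int_stableI)
      fix X Y assume "X \<in> E" "Y \<in> E"
      then obtain J a K b where *: "finite J" "J \<subseteq> I" "X = {z \<in> ?S. \<forall>i\<in>J. z i \<le> a i}"
        "finite K" "K \<subseteq> I" "Y = {z \<in> ?S. \<forall>i\<in>K. z i \<le> b i}"
        unfolding E_def by blast
      define c where "c i = (if i \<in> J then if i \<in> K then min (a i) (b i) else a i else b i)" for i
      have "X \<inter> Y = {z \<in> ?S. \<forall>i\<in>J \<union> K. z i \<le> c i}"
        unfolding * c_def by (auto split: if_splits)
      then show "X \<inter> Y \<in> E"
        using spE[of "J \<union> K" c] * by auto
    qed
    show "E \<subseteq> Pow ?S" by (auto simp: E_def)
    show "range (\<lambda>_. ?S) \<subseteq> E" using spE[of "{}"] by auto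
    show "emeasure P X = emeasure Q X" if "X \<in> E" for X
      using that eq unfolding E_def by blast
    show "emeasure P ?S \<noteq> \<infinity>"
      using fin sets_eq_imp_space_eq[OF P] by simp
  qed (use gen P Q in auto)
qed


text \<open>
  Coordinates of ratio maps are nonnegative, and only bounds \<open>a i > 0\<close> can be written as \<open>f / a i \<le> f0\<close>.
  A bound \<open>0\<close> is reached as a limit of the bounds \<open>1 / (n + 1)\<close>, and a negative bound gives a null set.
\<close>
lemma PiM_measure_eqI_positive_orthants:
  fixes P Q :: "('i \<Rightarrow> real) measure"
  assumes P: "sets P = sets (PiM I (\<lambda>_. borel))" and Q: "sets Q = sets (PiM I (\<lambda>_. borel))"
    and finP: "emeasure P (space P) \<noteq> \<infinity>" and finQ: "emeasure Q (space Q) \<noteq> \<infinity>"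
    and nnP: "\<And>i. i \<in> I \<Longrightarrow> AE z in P. 0 \<le> z i" and nnQ: "\<And>i. i \<in> I \<Longrightarrow> AE z in Q. 0 \<le> z i"
    and eq: "\<And>J a. finite J \<Longrightarrow> J \<subseteq> I \<Longrightarrow> \<forall>i\<in>J. 0 < a i \<Longrightarrow>
      emeasure P {z \<in> space (PiM I (\<lambda>_. borel)). \<forall>i\<in>J. z i \<le> a i} =
      emeasure Q {z \<in> space (PiM I (\<lambda>_. borel)). \<forall>i\<in>J. z i \<le> a i}"
  shows "P = Q"
proof (rule PiM_measure_eqI_lower_orthants[OF P Q finP])
  fix J :: "'i set" and a :: "'i \<Rightarrow> real" assume J: "finite J" "J \<subseteq> I"
  let ?S = "space (PiM I (\<lambda>_. borel :: real measure))"
  define B where "B b = {z \<in> ?S. \<forall>i\<in>J. z i \<le> b i}" for b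
  have Bs: "B b \<in> sets (PiM I (\<lambda>_. borel))" for b
    unfolding B_def using J by (rule sets_lower_orthant)
  show "emeasure P {z \<in> ?S. \<forall>i\<in>J. z i \<le> a i} = emeasure Q {z \<in> ?S. \<forall>i\<in>J. z i \<le> a i}"
  proof (cases "\<forall>i\<in>J. 0 \<le> a i")
    case True
    have lim: "(\<lambda>n. emeasure R (B (\<lambda>i. a i + 1 / real (Suc n)))) \<longlonglongrightarrow> emeasure R (B a)"
      if R: "sets R = sets (PiM I (\<lambda>_. borel))" "emeasure R (space R) \<noteq> \<infinity>" for R
    proof -
      have "(\<Inter>n. B (\<lambda>i. a i + 1 / real (Suc n))) = B a"
      proof (intro equalityI subsetI)
        fix z assume z: "z \<in> (\<Inter>n. B (\<lambda>i. a i + 1 / real (Suc n)))"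
        have "z i \<le> a i" if "i \<in> J" for i
        proof (rule LIMSEQ_le_const)
          show "(\<lambda>n. a i + 1 / real (Suc n)) \<longlonglongrightarrow> a i"
            using tendsto_add[OF tendsto_const LIMSEQ_Suc[OF lim_1_over_n]] by fastforce
          show "\<exists>N. \<forall>n\<ge>N. z i \<le> a i + 1 / real (Suc n)"
            using z that by (auto simp: B_def)
        qed
        then show "z \<in> B a" using z by (auto simp: B_def)
      next
        fix z assume "z \<in> B a"
        then show "z \<in> (\<Inter>n. B (\<lambda>i. a i + 1 / real (Suc n)))"
          by (auto simp: B_def intro: add_increasing2)
      qed
      moreover have "decseq (\<lambda>n. B (\<lambda>i. a i + 1 / real (Suc n)))"
      proof (rule decseq_SucI)
        fix n
        have "1 / real (Suc (Suc n)) \<le> 1 / real (Suc n)" by (simp add: frac_le)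
        then show "B (\<lambda>i. a i + 1 / real (Suc (Suc n))) \<subseteq> B (\<lambda>i. a i + 1 / real (Suc n))"
          unfolding B_def by (smt (verit) Collect_mono)
      qed
      moreover have "emeasure R (B (\<lambda>i. a i + 1 / real (Suc n))) \<noteq> \<infinity>" for n
        using R emeasure_space[of R "B (\<lambda>i. a i + 1 / real (Suc n))"] by (auto simp: top_unique)
      moreover have "range (\<lambda>n. B (\<lambda>i. a i + 1 / real (Suc n))) \<subseteq> sets R"
        using Bs R by auto
      ultimately show ?thesis
        using Lim_emeasure_decseq[of "\<lambda>n. B (\<lambda>i. a i + 1 / real (Suc n))" R] by simp
    qed
    have "0 < a i + 1 / real (Suc n)" if "i \<in> J" for i n
      using True that by (intro add_nonneg_pos) auto
    then have "emeasure P (B (\<lambda>i. a i + 1 / real (Suc n))) = emeasure Q (B (\<lambda>i. a i + 1 / real (Suc n)))" for n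
      unfolding B_def using J by (intro eq) auto
    then show ?thesis
      using lim[OF P finP] lim[OF Q finQ] LIMSEQ_unique unfolding B_def by fastforce
  next
    case False
    then obtain i where i: "i \<in> J" "i \<in> I" "a i < 0" using J by auto
    have "emeasure R (B a) = 0" if R: "AE z in R. 0 \<le> z i" "sets R = sets (PiM I (\<lambda>_. borel))" for R
    proof -
      have "AE z in R. z \<notin> B a"
        using R(1) by eventually_elim (use i in \<open>force simp: B_def\<close>)
      then show ?thesis
        using AE_iff_measurable[of "B a" R "\<lambda>z. z \<notin> B a"] Bs R(2) sets.sets_into_space[OF Bs[of a]]
          sets_eq_imp_space_eq[OF R(2)]
        by auto
    qed
    then show ?thesis
      using P Q nnP[OF i(2)] nnQ[OF i(2)] unfolding B_def by simp
  qed
qed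

section \<open>The ratio field as a field of preimages\<close>

text \<open>
  The two conventions for division by zero agree after projection to \<open>\<real>\<close>: the extended ratio is then
  \<open>0\<close> or \<open>\<infinity>\<close>, and \<^const>\<open>enn2real\<close> sends both to \<open>0\<close>, which is also the real quotient. Hence real quotients
  are measurable for the ratio field without any exceptional set.
\<close>
lemma real_ratio_eq_enn2real:
  fixes a b :: real
  assumes "0 \<le> a" "0 \<le> b"
  shows "a / b = enn2real (ennreal a / ennreal b)"
proof (cases "b = 0")
  case True
  then show ?thesis by (cases "a = 0") (use assms in \<open>auto simp: divide_ennreal_def ennreal_mult_top\<close>)
qed (use assms in \<open>simp add: divide_ennreal\<close>)

lemma ennreal_ratio_rescale:
  fixes a b c :: real
  assumes "0 \<le> a" "0 \<le> b" "0 < c"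
  shows "ennreal (a / c) / ennreal (b / c) = ennreal a / ennreal b"
proof (cases "b = 0")
  case True
  then show ?thesis by (cases "a = 0") (use assms in \<open>auto simp: divide_ennreal_def ennreal_mult_top\<close>)
qed (use assms in \<open>simp add: divide_ennreal\<close>)

lemma space_ratio_field [simp]: "space (ratio_field M F) = space M"
  by (simp add: ratio_field_def space_measure_of_conv)

lemma sets_ratio_field:
  "sets (ratio_field M F) = sigma_sets (space M)
     {(\<lambda>x. ennreal (f x) / ennreal (g x)) -` B \<inter> space M | f g B. f \<in> F \<and> g \<in> F \<and> B \<in> sets borel}"
  unfolding ratio_field_def by (rule sets_measure_of) auto

lemma ratio_measurable_ratio_field:
  assumes "F \<subseteq> Lplus \<alpha> M" "f \<in> F" "g \<in> F"
  shows "(\<lambda>x. f x / g x) \<in> borel_measurable (ratio_field M F)"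
proof -
  have "(\<lambda>x. ennreal (f x) / ennreal (g x)) \<in> borel_measurable (ratio_field M F)"
    using assms by (intro measurableI) (auto simp: sets_ratio_field intro!: sigma_sets.Basic)
  then have "(\<lambda>x. enn2real (ennreal (f x) / ennreal (g x))) \<in> borel_measurable (ratio_field M F)"
    by measurable
  moreover have "f x / g x = enn2real (ennreal (f x) / ennreal (g x))" if "x \<in> space (ratio_field M F)" for x
    using assms that LplusD(2)[of f \<alpha> M x] LplusD(2)[of g \<alpha> M x]
    by (intro real_ratio_eq_enn2real) auto
  ultimately show ?thesis
    by (rule measurable_cong[THEN iffD2, rotated])
qed

text \<open>
  Families are indexed rather than given as sets of functions because the image under \<open>U\<close> is indexed by
  \<open>F\<close> itself: this puts both sides in one product space even when \<open>U\<close> is not injective.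
\<close>
definition ratio_map :: "'i set \<Rightarrow> ('i \<Rightarrow> 'a \<Rightarrow> real) \<Rightarrow> 'i \<Rightarrow> 'a \<Rightarrow> 'i \<Rightarrow> real" where
  "ratio_map I \<phi> b x = (\<lambda>i\<in>I. \<phi> i x / \<phi> b x)"

lemma ratio_map_apply [simp]: "i \<in> I \<Longrightarrow> ratio_map I \<phi> b x i = \<phi> i x / \<phi> b x"
  by (simp add: ratio_map_def)

lemma ratio_map_in_space: "ratio_map I \<phi> b x \<in> space (PiM I (\<lambda>_. borel))"
  by (simp add: ratio_map_def space_PiM)

lemma ratio_map_measurable:
  assumes "\<phi> ` I \<subseteq> Lplus \<alpha> M" "b \<in> I"
  shows "ratio_map I \<phi> b \<in> measurable (ratio_field M (\<phi> ` I)) (PiM I (\<lambda>_. borel))"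
  unfolding ratio_map_def using assms
  by (intro measurable_restrict ratio_measurable_ratio_field) auto

lemma ratio_map_measurable':
  assumes "\<phi> ` I \<subseteq> Lplus \<alpha> M" "b \<in> I"
  shows "ratio_map I \<phi> b \<in> measurable M (PiM I (\<lambda>_. borel))"
  using measurable_from_subalg[OF subalgebra_ratio_field[OF assms(1)] ratio_map_measurable[OF assms]] .

text \<open>
  Where \<open>\<phi> b\<close> is nonzero, every ratio \<open>\<phi> i / \<phi> j\<close> is the quotient of the coordinates
  \<open>\<phi> i / \<phi> b\<close> and \<open>\<phi> j / \<phi> b\<close> of the ratio map. This settles the generators, and the property passes to
  complements and countable unions.
\<close>
lemma ratio_field_set_factorization:
  assumes L: "\<phi> ` I \<subseteq> Lplus \<alpha> M" and b: "b \<in> I" and A: "A \<in> sets (ratio_field M (\<phi> ` I))"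
  shows "\<exists>C\<in>sets (PiM I (\<lambda>_. borel)). \<forall>x\<in>space M. \<phi> b x \<noteq> 0 \<longrightarrow> (x \<in> A \<longleftrightarrow> ratio_map I \<phi> b x \<in> C)"
  using A unfolding sets_ratio_field
proof (induction rule: sigma_sets.induct)
  case (Basic A)
  then obtain i j B where ij: "i \<in> I" "j \<in> I" and B: "B \<in> sets borel"
    and A: "A = (\<lambda>x. ennreal (\<phi> i x) / ennreal (\<phi> j x)) -` B \<inter> space M"
    by auto
  let ?C = "(\<lambda>z. ennreal (z i) / ennreal (z j)) -` B \<inter> space (PiM I (\<lambda>_. borel))"
  have "(\<lambda>z. ennreal (z i) / ennreal (z j)) \<in> borel_measurable (PiM I (\<lambda>_. borel))"
    using ij by measurable
  then have "?C \<in> sets (PiM I (\<lambda>_. borel))"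
    using B by (rule measurable_sets)
  moreover have "x \<in> A \<longleftrightarrow> ratio_map I \<phi> b x \<in> ?C" if x: "x \<in> space M" "\<phi> b x \<noteq> 0" for x
  proof -
    have "0 \<le> \<phi> i x" "0 \<le> \<phi> j x" "0 < \<phi> b x"
      using L ij b x LplusD(2)[of _ \<alpha> M x] by (auto simp: image_subset_iff less_le)
    then show ?thesis
      using ij x by (simp add: A ratio_map_in_space ennreal_ratio_rescale)
  qed
  ultimately show ?case by blast
next
  case Empty
  then show ?case by (intro bexI[of _ "{}"]) auto
next
  case (Compl A)
  then obtain C where "C \<in> sets (PiM I (\<lambda>_. borel))"
    "\<forall>x\<in>space M. \<phi> b x \<noteq> 0 \<longrightarrow> (x \<in> A \<longleftrightarrow> ratio_map I \<phi> b x \<in> C)" by blast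
  then show ?case
    by (intro bexI[of _ "space (PiM I (\<lambda>_. borel)) - C"]) (auto simp: ratio_map_in_space)
next
  case (Union A)
  then obtain C where "\<And>n::nat. C n \<in> sets (PiM I (\<lambda>_. borel))"
    "\<And>n. \<forall>x\<in>space M. \<phi> b x \<noteq> 0 \<longrightarrow> (x \<in> A n \<longleftrightarrow> ratio_map I \<phi> b x \<in> C n)" by metis
  then show ?case
    by (intro bexI[of _ "\<Union>n. C n"]) auto
qed

lemma ratio_field_ennreal_factorization:
  fixes r :: "'a \<Rightarrow> ennreal"
  assumes L: "\<phi> ` I \<subseteq> Lplus \<alpha> M" and b: "b \<in> I" and r: "r \<in> borel_measurable (ratio_field M (\<phi> ` I))"
  shows "\<exists>g\<in>borel_measurable (PiM I (\<lambda>_. borel)). \<forall>x\<in>space M. \<phi> b x \<noteq> 0 \<longrightarrow> r x = g (ratio_map I \<phi> b x)"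
  using r
proof (induction rule: borel_measurable_induct)
  case (cong f g)
  then show ?case by simp
next
  case (set A)
  then obtain C where C: "C \<in> sets (PiM I (\<lambda>_. borel))"
    "\<forall>x\<in>space M. \<phi> b x \<noteq> 0 \<longrightarrow> (x \<in> A \<longleftrightarrow> ratio_map I \<phi> b x \<in> C)"
    using ratio_field_set_factorization[OF L b] by blast
  then show ?case
    by (intro bexI[of _ "indicator C"]) (auto simp: indicator_def)
next
  case (mult u c)
  then obtain g where "g \<in> borel_measurable (PiM I (\<lambda>_. borel))"
    "\<forall>x\<in>space M. \<phi> b x \<noteq> 0 \<longrightarrow> u x = g (ratio_map I \<phi> b x)" by blast
  then show ?case
    by (intro bexI[of _ "\<lambda>z. c * g z"]) auto
next
  case (add u v)
  then obtain g h where "g \<in> borel_measurable (PiM I (\<lambda>_. borel))" "h \<in> borel_measurable (PiM I (\<lambda>_. borel))"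
    "\<forall>x\<in>space M. \<phi> b x \<noteq> 0 \<longrightarrow> u x = g (ratio_map I \<phi> b x)"
    "\<forall>x\<in>space M. \<phi> b x \<noteq> 0 \<longrightarrow> v x = h (ratio_map I \<phi> b x)" by blast
  then show ?case
    by (intro bexI[of _ "\<lambda>z. h z + g z"]) auto
next
  case (seq V)
  then obtain g where "\<And>n. g n \<in> borel_measurable (PiM I (\<lambda>_. borel))"
    "\<And>n. \<forall>x\<in>space M. \<phi> b x \<noteq> 0 \<longrightarrow> V n x = g n (ratio_map I \<phi> b x)" by metis
  then show ?case
    by (intro bexI[of _ "\<lambda>z. SUP n. g n z"]) (auto simp: image_comp)
qed

text \<open>
  A Doob--Dynkin factorization. The factor of a nonnegative function is chosen nonnegative on the
  whole product space, not merely on the range of the ratio map, so that transporting it to another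
  space yields a function that is nonnegative everywhere.
\<close>
lemma ratio_field_function_factorization:
  fixes r :: "'a \<Rightarrow> real"
  assumes L: "\<phi> ` I \<subseteq> Lplus \<alpha> M" and b: "b \<in> I" and r: "r \<in> borel_measurable (ratio_field M (\<phi> ` I))"
  shows "\<exists>g\<in>borel_measurable (PiM I (\<lambda>_. borel)).
    (\<forall>x\<in>space M. \<phi> b x \<noteq> 0 \<longrightarrow> r x = g (ratio_map I \<phi> b x)) \<and>
    ((\<forall>x\<in>space M. 0 \<le> r x) \<longrightarrow> (\<forall>z. 0 \<le> g z))"
proof -
  have "(\<lambda>x. ennreal (r x)) \<in> borel_measurable (ratio_field M (\<phi> ` I))"
    "(\<lambda>x. ennreal (- r x)) \<in> borel_measurable (ratio_field M (\<phi> ` I))"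
    using r by measurable
  from this[THEN ratio_field_ennreal_factorization[OF L b]]
  obtain p n where [measurable]: "p \<in> borel_measurable (PiM I (\<lambda>_. borel))" "n \<in> borel_measurable (PiM I (\<lambda>_. borel))"
    and pn: "\<forall>x\<in>space M. \<phi> b x \<noteq> 0 \<longrightarrow> ennreal (r x) = p (ratio_map I \<phi> b x)"
      "\<forall>x\<in>space M. \<phi> b x \<noteq> 0 \<longrightarrow> ennreal (- r x) = n (ratio_map I \<phi> b x)"
    by blast
  define g where "g z = enn2real (p z) - (if \<forall>x\<in>space M. 0 \<le> r x then 0 else enn2real (n z))" for z
  have "r x = g (ratio_map I \<phi> b x)" if "x \<in> space M" "\<phi> b x \<noteq> 0" for x
  proof -
    have "p (ratio_map I \<phi> b x) = ennreal (r x)" "n (ratio_map I \<phi> b x) = ennreal (- r x)"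
      using that pn by auto
    then show ?thesis
      using that(1) by (cases "0 \<le> r x") (auto simp: g_def ennreal_neg)
  qed
  moreover have "g \<in> borel_measurable (PiM I (\<lambda>_. borel))"
    unfolding g_def by measurable
  ultimately show ?thesis
    by (intro bexI[of _ g]) (auto simp: g_def)
qed

section \<open>Equality of the laws of the ratios\<close>

lemma emeasure_distr_ratio_map_orthant:
  assumes L: "\<phi> ` I \<subseteq> Lplus \<alpha> M" and b: "b \<in> I" and \<alpha>: "0 < \<alpha>" and J: "finite J" "J \<subseteq> I"
    and k: "AE x in M. k x \<le> \<phi> b x \<longleftrightarrow> (\<forall>i\<in>J. \<phi> i x \<le> a i * \<phi> b x)" "k \<in> Lplus \<alpha> M"
  shows "emeasure (distr (density M (\<lambda>x. ennreal (\<phi> b x powr \<alpha>))) (PiM I (\<lambda>_. borel)) (ratio_map I \<phi> b))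
      {z \<in> space (PiM I (\<lambda>_. borel)). \<forall>i\<in>J. z i \<le> a i} =
    ennreal (\<integral>x. indicator {x. k x \<le> \<phi> b x} x * \<phi> b x powr \<alpha> \<partial>M)"
proof -
  note [measurable] = ratio_map_measurable'[OF L b] LplusD(1)[OF k(2)] sets_lower_orthant[OF J]
  have bL: "\<phi> b \<in> Lplus \<alpha> M" using L b by auto
  note [measurable] = LplusD(1)[OF bL]
  let ?B = "{z \<in> space (PiM I (\<lambda>_. borel)). \<forall>i\<in>J. z i \<le> a i}"
  have "emeasure (distr (density M (\<lambda>x. ennreal (\<phi> b x powr \<alpha>))) (PiM I (\<lambda>_. borel)) (ratio_map I \<phi> b)) ?B
    = emeasure (density M (\<lambda>x. ennreal (\<phi> b x powr \<alpha>))) (ratio_map I \<phi> b -` ?B \<inter> space M)"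
    by (subst emeasure_distr) auto
  also have "\<dots> = (\<integral>\<^sup>+ x. ennreal (\<phi> b x powr \<alpha>) * indicator (ratio_map I \<phi> b -` ?B \<inter> space M) x \<partial>M)"
    by (subst emeasure_density) auto
  also have "\<dots> = (\<integral>\<^sup>+ x. ennreal (indicator {x. k x \<le> \<phi> b x} x * \<phi> b x powr \<alpha>) \<partial>M)"
  proof (rule nn_integral_cong_AE)
    show "AE x in M. ennreal (\<phi> b x powr \<alpha>) * indicator (ratio_map I \<phi> b -` ?B \<inter> space M) x
      = ennreal (indicator {x. k x \<le> \<phi> b x} x * \<phi> b x powr \<alpha>)"
      using k(1) AE_space
    proof eventually_elim
      case (elim x)
      show ?case
      proof (cases "\<phi> b x = 0")
        case False
        then have "0 < \<phi> b x" using LplusD(2)[OF bL elim(2)] by simp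
        then have "ratio_map I \<phi> b x \<in> ?B \<longleftrightarrow> (\<forall>i\<in>J. \<phi> i x \<le> a i * \<phi> b x)"
          using J(2) by (auto simp: ratio_map_in_space pos_divide_le_eq subset_iff)
        then show ?thesis
          using elim by (auto simp: indicator_def)
      qed simp
    qed
  qed
  also have "\<dots> = ennreal (\<integral>x. indicator {x. k x \<le> \<phi> b x} x * \<phi> b x powr \<alpha> \<partial>M)"
  proof (rule nn_integral_eq_integral)
    show "integrable M (\<lambda>x. indicator {x. k x \<le> \<phi> b x} x * \<phi> b x powr \<alpha>)"
      by (rule Bochner_Integration.integrable_bound[OF LplusD(4)[OF bL]])
         (auto simp: indicator_def)
  qed (auto simp: indicator_def)
  finally show ?thesis .
qed

lemma finite_distr_ratio_map:
  assumes L: "\<phi> ` I \<subseteq> Lplus \<alpha> M" and b: "b \<in> I"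
  defines "D \<equiv> distr (density M (\<lambda>x. ennreal (\<phi> b x powr \<alpha>))) (PiM I (\<lambda>_. borel)) (ratio_map I \<phi> b)"
  shows "emeasure D (space D) \<noteq> \<infinity>" "\<And>i. i \<in> I \<Longrightarrow> AE z in D. 0 \<le> z i"
proof -
  note [measurable] = ratio_map_measurable'[OF L b]
  have bL: "\<phi> b \<in> Lplus \<alpha> M" using L b by auto
  note [measurable] = LplusD(1)[OF bL]
  have "emeasure D (space D) = (\<integral>\<^sup>+ x. ennreal (\<phi> b x powr \<alpha>) * indicator (ratio_map I \<phi> b -` space (PiM I (\<lambda>_. borel)) \<inter> space M) x \<partial>M)"
    unfolding D_def by (simp add: emeasure_distr emeasure_density)
  also have "\<dots> = (\<integral>\<^sup>+ x. ennreal (\<phi> b x powr \<alpha>) \<partial>M)"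
    by (rule nn_integral_cong) (auto simp: ratio_map_in_space)
  finally show "emeasure D (space D) \<noteq> \<infinity>"
    using LplusD(3)[OF bL] by simp
  fix i assume [measurable]: "i \<in> I"
  have "AE x in density M (\<lambda>x. ennreal (\<phi> b x powr \<alpha>)). 0 \<le> ratio_map I \<phi> b x i"
  proof (rule AE_I2)
    fix x assume "x \<in> space (density M (\<lambda>x. ennreal (\<phi> b x powr \<alpha>)))"
    then show "0 \<le> ratio_map I \<phi> b x i"
      using LplusD(2)[OF bL, of x] LplusD(2)[of "\<phi> i" \<alpha> M x] L \<open>i \<in> I\<close> by auto
  qed
  then show "AE z in D. 0 \<le> z i"
    unfolding D_def by (subst AE_distr_iff) auto
qed

lemma nn_integral_distr_density:
  assumes [measurable]: "T \<in> measurable M N" "h \<in> borel_measurable M" "g \<in> borel_measurable N"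
  shows "nn_integral (distr (density M h) N T) g = (\<integral>\<^sup>+ x. h x * g (T x) \<partial>M)"
proof -
  have "nn_integral (distr (density M h) N T) g = (\<integral>\<^sup>+ x. g (T x) \<partial>density M h)"
    by (rule nn_integral_distr) simp_all
  also have "\<dots> = (\<integral>\<^sup>+ x. h x * g (T x) \<partial>M)"
    by (rule nn_integral_density) simp_all
  finally show ?thesis .
qed

text \<open>
  These properties are shared by two families: \<open>F\<close> with \<open>U\<close>, and the extended ratio space of \<open>F\<close> with any
  isometric extension of \<open>U\<close>. The second instance is what uniqueness of the extension rests on.
\<close>
locale max_isometry_frame =
  fixes \<alpha> :: real and M1 :: "'a measure" and M2 :: "'b measure"
    and F :: "('a \<Rightarrow> real) set" and U :: "('a \<Rightarrow> real) \<Rightarrow> 'b \<Rightarrow> real" and f0 :: "'a \<Rightarrow> real"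
  assumes \<alpha>_pos: "0 < \<alpha>"
    and F_Lplus: "F \<subseteq> Lplus \<alpha> M1"
    and max_in_F: "\<And>f g a b. f \<in> F \<Longrightarrow> g \<in> F \<Longrightarrow> 0 < a \<Longrightarrow> 0 < b \<Longrightarrow> (\<lambda>x. max (a * f x) (b * g x)) \<in> F"
    and isometry: "max_linear_isometry \<alpha> M1 M2 F U"
    and f0_in: "f0 \<in> F"
    and f0_nonzero: "AE x in M1. f0 x \<noteq> 0"
begin

abbreviation "P \<equiv> PiM F (\<lambda>_. borel :: real measure)"
abbreviation "\<Phi>1 \<equiv> ratio_map F (\<lambda>f. f) f0"
abbreviation "\<Phi>2 \<equiv> ratio_map F U f0"

lemma U_Lplus: "f \<in> F \<Longrightarrow> U f \<in> Lplus \<alpha> M2"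
  using isometry by (auto simp: max_linear_isometry_def)

lemma UF_Lplus: "U ` F \<subseteq> Lplus \<alpha> M2"
  using U_Lplus by auto

lemma id_F_Lplus: "(\<lambda>f. f) ` F \<subseteq> Lplus \<alpha> M1"
  using F_Lplus by auto

lemma F_measurable: "f \<in> F \<Longrightarrow> f \<in> borel_measurable M1"
  by (rule LplusD(1)[OF subsetD[OF F_Lplus]])

lemma U_measurable: "f \<in> F \<Longrightarrow> U f \<in> borel_measurable M2"
  by (rule LplusD(1)[OF U_Lplus])

lemma f0_measurable [measurable]: "f0 \<in> borel_measurable M1"
  using F_measurable[OF f0_in] .

lemma Uf0_measurable [measurable]: "U f0 \<in> borel_measurable M2"
  using U_measurable[OF f0_in] .

lemma F_nonneg: "f \<in> F \<Longrightarrow> x \<in> space M1 \<Longrightarrow> 0 \<le> f x"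
  by (rule LplusD(2)[OF subsetD[OF F_Lplus]])

lemma U_nonneg: "f \<in> F \<Longrightarrow> y \<in> space M2 \<Longrightarrow> 0 \<le> U f y"
  by (rule LplusD(2)[OF U_Lplus])

lemma U_max:
  "f \<in> F \<Longrightarrow> g \<in> F \<Longrightarrow> 0 \<le> a \<Longrightarrow> 0 \<le> b \<Longrightarrow>
    AE y in M2. U (\<lambda>x. max (a * f x) (b * g x)) y = max (a * U f y) (b * U g y)"
  using isometry[unfolded max_linear_isometry_def] by simp

lemma U_nn_integral:
  assumes "f \<in> F"
  shows "(\<integral>\<^sup>+ y. ennreal (U f y powr \<alpha>) \<partial>M2) = (\<integral>\<^sup>+ x. ennreal (f x powr \<alpha>) \<partial>M1)"
proof -
  have "Lplus_norm \<alpha> M2 (U f) = Lplus_norm \<alpha> M1 f"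
    using isometry assms unfolding max_linear_isometry_def by blast
  moreover have "f \<in> Lplus \<alpha> M1" using assms F_Lplus by auto
  ultimately show ?thesis
    using Lplus_norm_eq_iff[OF \<alpha>_pos U_Lplus[OF assms], of f M1] by simp
qed

lemma U_integral:
  assumes "f \<in> F"
  shows "(\<integral> y. U f y powr \<alpha> \<partial>M2) = (\<integral> x. f x powr \<alpha> \<partial>M1)"
proof -
  have "(\<integral> y. U f y powr \<alpha> \<partial>M2) = enn2real (\<integral>\<^sup>+ y. ennreal (U f y powr \<alpha>) \<partial>M2)"
    using U_measurable[OF assms] by (intro integral_eq_nn_integral) simp_all
  also have "\<dots> = (\<integral> x. f x powr \<alpha> \<partial>M1)"
    unfolding U_nn_integral[OF assms] using F_measurable[OF assms]
    by (intro integral_eq_nn_integral[symmetric]) simp_all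
  finally show ?thesis .
qed

text \<open>
  For \<open>c > 0\<close> the function \<open>c f \<or> k\<close> belongs to \<open>F\<close> and has image \<open>c U f \<or> U k\<close>, so the two integrals of
  \<open>\<alpha>\<close>-th powers agree for all \<open>c\<close>, and therefore so do their right derivatives at \<open>c = 1\<close>.
\<close>
lemma integral_dominated_part:
  assumes f: "f \<in> F" and k: "k \<in> F"
  shows "(\<integral> y. indicator {y. U k y \<le> U f y} y * U f y powr \<alpha> \<partial>M2) =
    (\<integral> x. indicator {x. k x \<le> f x} x * f x powr \<alpha> \<partial>M1)"
proof -
  have eq: "(\<integral> y. max (c * U f y) (U k y) powr \<alpha> \<partial>M2) = (\<integral> x. max (c * f x) (k x) powr \<alpha> \<partial>M1)"
    if "0 < c" for c
  proof -
    define u where "u = (\<lambda>x. max (c * f x) (1 * k x))"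
    have u: "u \<in> F"
      unfolding u_def using max_in_F[OF f k, of c 1] that by simp
    have "AE y in M2. U u y = max (c * U f y) (1 * U k y)"
      unfolding u_def using U_max[OF f k, of c 1] that by simp
    then have "(\<integral> y. max (c * U f y) (U k y) powr \<alpha> \<partial>M2) = (\<integral> y. U u y powr \<alpha> \<partial>M2)"
      using U_measurable[OF f] U_measurable[OF k] U_measurable[OF u] by (intro integral_cong_AE) auto
    also have "\<dots> = (\<integral> x. max (c * f x) (k x) powr \<alpha> \<partial>M1)"
      using U_integral[OF u] by (simp add: u_def)
    finally show ?thesis .
  qed
  have c: "0 < (1 + 1 / real (Suc n)) powr (1 / \<alpha>)" for n
  proof -
    have "0 < 1 + 1 / real (Suc n)" by (rule add_pos_nonneg) auto
    then show ?thesis by simp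
  qed
  have "f \<in> Lplus \<alpha> M1" "k \<in> Lplus \<alpha> M1" using f k F_Lplus by auto
  from right_derivative_integral_max[OF \<alpha>_pos this]
    right_derivative_integral_max[OF \<alpha>_pos U_Lplus[OF f] U_Lplus[OF k]]
  show ?thesis
    using eq[OF zero_less_one] unfolding eq[OF c] mult_1 by (simp add: LIMSEQ_unique)
qed

text \<open>
  The witness is the maximum of \<open>f0\<close> and of all \<open>i / a i\<close>. Starting the maximum from \<open>f0\<close> covers
  an empty \<open>J\<close> and does not affect the condition \<open>k \<le> f0\<close>.
\<close>
lemma finite_max_in_F:
  assumes "finite J" "J \<subseteq> F" "\<forall>i\<in>J. 0 < a i"
  shows "\<exists>k\<in>F. (\<forall>x. k x \<le> f0 x \<longleftrightarrow> (\<forall>i\<in>J. i x \<le> a i * f0 x)) \<and>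
    (AE y in M2. U k y \<le> U f0 y \<longleftrightarrow> (\<forall>i\<in>J. U i y \<le> a i * U f0 y))"
  using assms
proof (induction rule: finite_induct)
  case empty
  show ?case using f0_in by auto
next
  case (insert i J)
  then obtain k where k: "k \<in> F" "\<forall>x. k x \<le> f0 x \<longleftrightarrow> (\<forall>i\<in>J. i x \<le> a i * f0 x)"
    "AE y in M2. U k y \<le> U f0 y \<longleftrightarrow> (\<forall>i\<in>J. U i y \<le> a i * U f0 y)"
    by auto
  have i: "i \<in> F" "0 < a i" using insert by auto
  define l where "l = (\<lambda>x. max (1 * k x) (1 / a i * i x))"
  have le: "max (1 * s) (1 / a i * t) \<le> u \<longleftrightarrow> s \<le> u \<and> t \<le> a i * u" for s t u :: real
    using i(2) by (auto simp: field_simps)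
  have "l \<in> F"
    unfolding l_def using max_in_F[OF k(1) i(1), of 1 "1 / a i"] i(2) by simp
  moreover have "l x \<le> f0 x \<longleftrightarrow> (\<forall>i\<in>insert i J. i x \<le> a i * f0 x)" for x
    unfolding l_def le using k(2) by auto
  moreover have "AE y in M2. U l y \<le> U f0 y \<longleftrightarrow> (\<forall>i\<in>insert i J. U i y \<le> a i * U f0 y)"
  proof -
    have "AE y in M2. U l y = max (1 * U k y) (1 / a i * U i y)"
      unfolding l_def using U_max[OF k(1) i(1), of 1 "1 / a i"] i(2) by simp
    with k(3) show ?thesis
      by eventually_elim (use le in auto)
  qed
  ultimately show ?case by blast
qed

text \<open>
  The density \<open>(U f0)\<^sup>\<alpha>\<close> discards the set where \<open>U f0\<close> vanishes. This is why the equality of laws can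
  precede, and then imply, the fact that \<open>U f0\<close> has full support.
\<close>
lemma ratio_map_distr_eq:
  "distr (density M1 (\<lambda>x. ennreal (f0 x powr \<alpha>))) P \<Phi>1 =
   distr (density M2 (\<lambda>y. ennreal (U f0 y powr \<alpha>))) P \<Phi>2"
  (is "?D1 = ?D2")
proof (rule PiM_measure_eqI_positive_orthants)
  fix J and a :: "('a \<Rightarrow> real) \<Rightarrow> real"
  assume J: "finite J" "J \<subseteq> F" "\<forall>i\<in>J. 0 < a i"
  obtain k where k: "k \<in> F" "\<forall>x. k x \<le> f0 x \<longleftrightarrow> (\<forall>i\<in>J. i x \<le> a i * f0 x)"
    "AE y in M2. U k y \<le> U f0 y \<longleftrightarrow> (\<forall>i\<in>J. U i y \<le> a i * U f0 y)"
    using finite_max_in_F[OF J] by blast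
  have "k \<in> Lplus \<alpha> M1" using k(1) F_Lplus by auto
  then show "emeasure ?D1 {z \<in> space P. \<forall>i\<in>J. z i \<le> a i} = emeasure ?D2 {z \<in> space P. \<forall>i\<in>J. z i \<le> a i}"
    using emeasure_distr_ratio_map_orthant[OF id_F_Lplus f0_in \<alpha>_pos J(1,2), of k a]
      emeasure_distr_ratio_map_orthant[OF UF_Lplus f0_in \<alpha>_pos J(1,2) k(3) U_Lplus[OF k(1)]]
      integral_dominated_part[OF f0_in k(1)] k(2) by simp
next
  show "emeasure ?D1 (space ?D1) \<noteq> \<infinity>" "\<And>i. i \<in> F \<Longrightarrow> AE z in ?D1. 0 \<le> z i"
    using finite_distr_ratio_map[OF id_F_Lplus f0_in] .
  show "emeasure ?D2 (space ?D2) \<noteq> \<infinity>" "\<And>i. i \<in> F \<Longrightarrow> AE z in ?D2. 0 \<le> z i"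
    using finite_distr_ratio_map[OF UF_Lplus f0_in] .
qed (rule sets_distr)+

lemma \<Phi>1_measurable [measurable]: "\<Phi>1 \<in> measurable M1 P"
  using ratio_map_measurable'[OF id_F_Lplus f0_in] .

lemma \<Phi>2_measurable [measurable]: "\<Phi>2 \<in> measurable M2 P"
  using ratio_map_measurable'[OF UF_Lplus f0_in] .

lemma nn_integral_transfer:
  assumes [measurable]: "g \<in> borel_measurable P"
  shows "(\<integral>\<^sup>+ x. g (\<Phi>1 x) * ennreal (f0 x powr \<alpha>) \<partial>M1) = (\<integral>\<^sup>+ y. g (\<Phi>2 y) * ennreal (U f0 y powr \<alpha>) \<partial>M2)"
proof -
  have "(\<integral>\<^sup>+ x. g (\<Phi>1 x) * ennreal (f0 x powr \<alpha>) \<partial>M1) =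
    nn_integral (distr (density M1 (\<lambda>x. ennreal (f0 x powr \<alpha>))) P \<Phi>1) g"
    by (subst nn_integral_distr_density) (simp_all add: mult.commute)
  also have "\<dots> = nn_integral (distr (density M2 (\<lambda>y. ennreal (U f0 y powr \<alpha>))) P \<Phi>2) g"
    by (simp only: ratio_map_distr_eq)
  also have "\<dots> = (\<integral>\<^sup>+ y. g (\<Phi>2 y) * ennreal (U f0 y powr \<alpha>) \<partial>M2)"
    by (subst nn_integral_distr_density) (simp_all add: mult.commute)
  finally show ?thesis .
qed

text \<open>
  Both sides say that the common law of the ratios gives measure \<open>0\<close> to the failure of \<open>Q\<close>. The
  asymmetry arises because \<open>{f0 = 0}\<close> is a null set, whereas \<open>{U f0 = 0}\<close> may have positive measure.
\<close>
lemma AE_transfer: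
  assumes [measurable]: "Measurable.pred P Q"
  shows "(AE x in M1. Q (\<Phi>1 x)) \<longleftrightarrow> (AE y in M2. U f0 y \<noteq> 0 \<longrightarrow> Q (\<Phi>2 y))"
proof -
  let ?g = "\<lambda>z. indicator {z \<in> space P. \<not> Q z} z :: ennreal"
  have "(AE x in M1. Q (\<Phi>1 x)) \<longleftrightarrow> (AE x in M1. ?g (\<Phi>1 x) * ennreal (f0 x powr \<alpha>) = 0)"
    using f0_nonzero
    by (intro eventually_subst, eventually_elim) (simp add: ratio_map_in_space indicator_def)
  also have "\<dots> \<longleftrightarrow> (\<integral>\<^sup>+ x. ?g (\<Phi>1 x) * ennreal (f0 x powr \<alpha>) \<partial>M1) = 0"
    by (subst nn_integral_0_iff_AE) auto
  also have "\<dots> \<longleftrightarrow> (\<integral>\<^sup>+ y. ?g (\<Phi>2 y) * ennreal (U f0 y powr \<alpha>) \<partial>M2) = 0"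
    by (subst nn_integral_transfer) auto
  also have "\<dots> \<longleftrightarrow> (AE y in M2. ?g (\<Phi>2 y) * ennreal (U f0 y powr \<alpha>) = 0)"
    by (subst nn_integral_0_iff_AE) auto
  also have "\<dots> \<longleftrightarrow> (AE y in M2. U f0 y \<noteq> 0 \<longrightarrow> Q (\<Phi>2 y))"
    by (intro eventually_subst AE_I2) (auto simp: ratio_map_in_space indicator_def)
  finally show ?thesis .
qed

lemma ratio_powr:
  assumes "0 \<le> s" "0 \<le> t" "t = 0 \<longrightarrow> s = 0"
  shows "ennreal ((s / t) powr \<alpha>) * ennreal (t powr \<alpha>) = ennreal (s powr \<alpha>)"
proof (cases "t = 0")
  case False
  then have "(s / t) powr \<alpha> * t powr \<alpha> = s powr \<alpha>"
    using assms by (simp add: powr_divide)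
  then show ?thesis
    by (simp add: ennreal_mult[symmetric])
qed (use assms in simp)

text \<open>
  Transferring \<open>\<integral> (f / f0)\<^sup>\<alpha> f0\<^sup>\<alpha>\<close> shows that the part of \<open>\<integral> (U f)\<^sup>\<alpha>\<close> over \<open>{U f0 \<noteq> 0}\<close> already has
  the full value \<open>\<integral> f\<^sup>\<alpha> = \<integral> (U f)\<^sup>\<alpha>\<close>. This value is finite, so nothing is left for \<open>{U f0 = 0}\<close>.
\<close>
lemma U_zero_off_support:
  assumes f: "f \<in> F"
  shows "AE y in M2. U f0 y = 0 \<longrightarrow> U f y = 0"
proof -
  note [measurable] = F_measurable[OF f] U_measurable[OF f] f
  have fin: "(\<integral>\<^sup>+ y. ennreal (U f y powr \<alpha>) \<partial>M2) < \<infinity>"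
    using LplusD(3)[OF U_Lplus[OF f]] .
  have "(\<integral>\<^sup>+ x. ennreal (f x powr \<alpha>) \<partial>M1) = (\<integral>\<^sup>+ x. ennreal (\<Phi>1 x f powr \<alpha>) * ennreal (f0 x powr \<alpha>) \<partial>M1)"
    using f0_nonzero AE_space
    by (intro nn_integral_cong_AE, eventually_elim)
       (use f f0_in F_nonneg in \<open>simp add: ratio_powr\<close>)
  also have "\<dots> = (\<integral>\<^sup>+ y. ennreal (\<Phi>2 y f powr \<alpha>) * ennreal (U f0 y powr \<alpha>) \<partial>M2)"
    by (rule nn_integral_transfer) measurable
  also have "\<dots> = (\<integral>\<^sup>+ y. (if U f0 y = 0 then 0 else ennreal (U f y powr \<alpha>)) \<partial>M2)"
    by (intro nn_integral_cong) (use f f0_in U_nonneg in \<open>simp add: ratio_powr\<close>)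
  finally have eq: "(\<integral>\<^sup>+ y. ennreal (U f y powr \<alpha>) \<partial>M2) = (\<integral>\<^sup>+ y. (if U f0 y = 0 then 0 else ennreal (U f y powr \<alpha>)) \<partial>M2)"
    using U_nn_integral[OF f] by simp
  have "(\<integral>\<^sup>+ y. (if U f0 y = 0 then ennreal (U f y powr \<alpha>) else 0) \<partial>M2) + (\<integral>\<^sup>+ y. ennreal (U f y powr \<alpha>) \<partial>M2)
     = (\<integral>\<^sup>+ y. ennreal (U f y powr \<alpha>) \<partial>M2)"
    by (subst eq, subst nn_integral_add[symmetric])
       (auto intro!: nn_integral_cong)
  then have "(\<integral>\<^sup>+ y. (if U f0 y = 0 then ennreal (U f y powr \<alpha>) else 0) \<partial>M2) = 0"
    using fin ennreal_add_left_cancel[of "\<integral>\<^sup>+ y. ennreal (U f y powr \<alpha>) \<partial>M2" _ 0] by (auto simp: add.commute)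
  then have "AE y in M2. (if U f0 y = 0 then ennreal (U f y powr \<alpha>) else 0) = 0"
    by (subst (asm) nn_integral_0_iff_AE) auto
  then show ?thesis
    by eventually_elim (auto split: if_splits)
qed

section \<open>The regular set isomorphism and its function map\<close>

abbreviation "R1 \<equiv> ratio_field M1 F"
abbreviation "R2 \<equiv> ratio_field M2 (U ` F)"

lemma \<Phi>1_ratio_measurable [measurable]: "\<Phi>1 \<in> measurable R1 P"
  using ratio_map_measurable[OF id_F_Lplus f0_in] by simp

lemma \<Phi>2_ratio_measurable [measurable]: "\<Phi>2 \<in> measurable R2 P"
  using ratio_map_measurable[OF UF_Lplus f0_in] .

lemma subalgebra_R1: "subalgebra M1 R1"
  using subalgebra_ratio_field[OF F_Lplus] .

lemma subalgebra_R2: "subalgebra M2 R2"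
  using subalgebra_ratio_field[OF UF_Lplus] .

lemma R1_D: "A \<in> sets R1 \<Longrightarrow> A \<in> sets M1"
  using subalgebra_R1 by (auto simp: subalgebra_def)

lemma R2_D: "A \<in> sets R2 \<Longrightarrow> A \<in> sets M2"
  using subalgebra_R2 by (auto simp: subalgebra_def)

lemma ratio_R1: "f \<in> F \<Longrightarrow> g \<in> F \<Longrightarrow> (\<lambda>x. f x / g x) \<in> borel_measurable R1"
  using ratio_measurable_ratio_field[OF F_Lplus] .

lemma ratio_R2: "f \<in> F \<Longrightarrow> g \<in> F \<Longrightarrow> (\<lambda>y. U f y / U g y) \<in> borel_measurable R2"
  using ratio_measurable_ratio_field[OF UF_Lplus, of "U f" "U g"] by simp

lemma pred_support_R2 [measurable]: "Measurable.pred R2 (\<lambda>y. U f0 y = 0)"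
proof -
  note [measurable] = ratio_R2[OF f0_in f0_in]
  have "Measurable.pred R2 (\<lambda>y. U f0 y / U f0 y = 0)" by measurable
  also have "(\<lambda>y. U f0 y / U f0 y = 0) = (\<lambda>y. U f0 y = 0)" by auto
  finally show ?thesis .
qed

definition set_rep :: "'a set \<Rightarrow> (('a \<Rightarrow> real) \<Rightarrow> real) set" where
  "set_rep A = (SOME C. C \<in> sets P \<and> (\<forall>x\<in>space M1. f0 x \<noteq> 0 \<longrightarrow> (x \<in> A \<longleftrightarrow> \<Phi>1 x \<in> C)))"

definition set_map :: "'a set \<Rightarrow> 'b set" where
  "set_map A = {y \<in> space M2. U f0 y \<noteq> 0 \<and> \<Phi>2 y \<in> set_rep A}"

definition fun_rep :: "('a \<Rightarrow> real) \<Rightarrow> (('a \<Rightarrow> real) \<Rightarrow> real) \<Rightarrow> real" where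
  "fun_rep r = (SOME g. g \<in> borel_measurable P \<and>
     (\<forall>x\<in>space M1. f0 x \<noteq> 0 \<longrightarrow> r x = g (\<Phi>1 x)) \<and>
     ((\<forall>x\<in>space M1. 0 \<le> r x) \<longrightarrow> (\<forall>z. 0 \<le> g z)))"

definition fun_map :: "('a \<Rightarrow> real) \<Rightarrow> 'b \<Rightarrow> real" where
  "fun_map r y = (if U f0 y = 0 then 0 else fun_rep r (\<Phi>2 y))"

lemma set_rep:
  assumes "A \<in> sets R1"
  shows "set_rep A \<in> sets P" "\<And>x. x \<in> space M1 \<Longrightarrow> f0 x \<noteq> 0 \<Longrightarrow> x \<in> A \<longleftrightarrow> \<Phi>1 x \<in> set_rep A"
proof -
  have "\<exists>C. C \<in> sets P \<and> (\<forall>x\<in>space M1. f0 x \<noteq> 0 \<longrightarrow> (x \<in> A \<longleftrightarrow> \<Phi>1 x \<in> C))"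
    using ratio_field_set_factorization[OF id_F_Lplus f0_in, of A] assms by auto
  from someI_ex[OF this]
  show "set_rep A \<in> sets P" "\<And>x. x \<in> space M1 \<Longrightarrow> f0 x \<noteq> 0 \<Longrightarrow> x \<in> A \<longleftrightarrow> \<Phi>1 x \<in> set_rep A"
    unfolding set_rep_def by blast+
qed

lemma set_rep_AE:
  assumes "A \<in> sets R1"
  shows "AE x in M1. x \<in> A \<longleftrightarrow> \<Phi>1 x \<in> set_rep A"
  using f0_nonzero AE_space by eventually_elim (use set_rep(2)[OF assms] in auto)

lemma fun_rep:
  assumes "r \<in> borel_measurable R1"
  shows "fun_rep r \<in> borel_measurable P"
    "\<And>x. x \<in> space M1 \<Longrightarrow> f0 x \<noteq> 0 \<Longrightarrow> r x = fun_rep r (\<Phi>1 x)"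
    "\<And>z. (\<And>x. x \<in> space M1 \<Longrightarrow> 0 \<le> r x) \<Longrightarrow> 0 \<le> fun_rep r z"
proof -
  have "\<exists>g. g \<in> borel_measurable P \<and> (\<forall>x\<in>space M1. f0 x \<noteq> 0 \<longrightarrow> r x = g (\<Phi>1 x)) \<and>
     ((\<forall>x\<in>space M1. 0 \<le> r x) \<longrightarrow> (\<forall>z. 0 \<le> g z))"
    using ratio_field_function_factorization[OF id_F_Lplus f0_in, of r] assms by (simp add: Bex_def)
  from someI_ex[OF this]
  show "fun_rep r \<in> borel_measurable P"
    "\<And>x. x \<in> space M1 \<Longrightarrow> f0 x \<noteq> 0 \<Longrightarrow> r x = fun_rep r (\<Phi>1 x)"
    "\<And>z. (\<And>x. x \<in> space M1 \<Longrightarrow> 0 \<le> r x) \<Longrightarrow> 0 \<le> fun_rep r z"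
    unfolding fun_rep_def by blast+
qed

lemma fun_rep_AE:
  assumes "r \<in> borel_measurable R1"
  shows "AE x in M1. r x = fun_rep r (\<Phi>1 x)"
  using f0_nonzero AE_space by eventually_elim (use fun_rep(2)[OF assms] in auto)

lemma set_map_in_R2: "A \<in> sets R1 \<Longrightarrow> set_map A \<in> sets R2"
proof -
  assume "A \<in> sets R1"
  then have [measurable]: "set_rep A \<in> sets P" by (rule set_rep)
  have "{y \<in> space R2. U f0 y \<noteq> 0 \<and> \<Phi>2 y \<in> set_rep A} \<in> sets R2" by measurable
  then show ?thesis by (simp add: set_map_def)
qed

text \<open>
  Independence of the chosen representative: any \<open>C\<close> that describes \<open>A\<close> almost everywhere may be used.
\<close>
lemma set_map_AE:
  assumes A: "A \<in> sets R1" and [measurable]: "C \<in> sets P"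
    and AC: "AE x in M1. x \<in> A \<longleftrightarrow> \<Phi>1 x \<in> C"
  shows "AE y in M2. y \<in> set_map A \<longleftrightarrow> U f0 y \<noteq> 0 \<and> \<Phi>2 y \<in> C"
proof -
  note [measurable] = set_rep(1)[OF A]
  have "AE x in M1. \<Phi>1 x \<in> set_rep A \<longleftrightarrow> \<Phi>1 x \<in> C"
    using AC set_rep_AE[OF A] by eventually_elim auto
  then have "AE y in M2. U f0 y \<noteq> 0 \<longrightarrow> (\<Phi>2 y \<in> set_rep A \<longleftrightarrow> \<Phi>2 y \<in> C)"
    by (subst AE_transfer[symmetric]) auto
  then show ?thesis
    using AE_space by eventually_elim (auto simp: set_map_def)
qed

lemma set_map_space_AE: "AE y in M2. y \<in> set_map (space M1) \<longleftrightarrow> U f0 y \<noteq> 0"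
proof -
  have "AE y in M2. y \<in> set_map (space M1) \<longleftrightarrow> U f0 y \<noteq> 0 \<and> \<Phi>2 y \<in> space P"
    by (rule set_map_AE) (auto simp: ratio_map_in_space sets.top[of R1, simplified])
  then show ?thesis by (simp add: ratio_map_in_space)
qed

lemma fun_map_measurable:
  assumes "r \<in> borel_measurable R1"
  shows "fun_map r \<in> borel_measurable R2"
proof -
  note [measurable] = fun_rep(1)[OF assms]
  show ?thesis unfolding fun_map_def by measurable
qed

lemma fun_map_ratio_functions:
  assumes "r \<in> ratio_functions M1 F"
  shows "fun_map r \<in> ratio_functions M2 (U ` F)"
proof -
  have "r \<in> borel_measurable R1" "\<And>x. x \<in> space M1 \<Longrightarrow> 0 \<le> r x"
    using assms by (auto simp: ratio_functions_def)
  then show ?thesis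
    using fun_map_measurable[of r] fun_rep(3)[of r] by (auto simp: ratio_functions_def fun_map_def)
qed

text \<open>
  The counterpart for functions: any factor \<open>g\<close> of \<open>r\<close>, valid almost everywhere, computes the image.
\<close>
lemma fun_map_AE:
  assumes r: "r \<in> borel_measurable R1" and g: "g \<in> borel_measurable P"
    and rg: "AE x in M1. r x = g (\<Phi>1 x)"
  shows "AE y in M2. fun_map r y = (if U f0 y = 0 then 0 else g (\<Phi>2 y))"
proof -
  have "AE x in M1. fun_rep r (\<Phi>1 x) = g (\<Phi>1 x)"
    using rg fun_rep_AE[OF r] by eventually_elim auto
  moreover have "Measurable.pred P (\<lambda>z. fun_rep r z = g z)"
    unfolding pred_def using fun_rep(1)[OF r] g by (rule borel_measurable_eq)
  ultimately have "AE y in M2. U f0 y \<noteq> 0 \<longrightarrow> fun_rep r (\<Phi>2 y) = g (\<Phi>2 y)"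
    using AE_transfer by blast
  then show ?thesis
    by eventually_elim (auto simp: fun_map_def)
qed

lemma sets_ratio_measure1: "sets (ratio_measure M1 F) = sets R1"
  unfolding ratio_measure_def by (rule sets_restr_to_subalg[OF subalgebra_R1])

lemma sets_ratio_measure2: "sets (ratio_measure M2 (U ` F)) = sets R2"
  unfolding ratio_measure_def by (rule sets_restr_to_subalg[OF subalgebra_R2])

lemma space_ratio_measure: "space (ratio_measure M G) = space M"
  by (simp add: ratio_measure_def space_restr_to_subalg)

lemma eq_mod_null_ratio_measure2:
  assumes [measurable]: "A \<in> sets R2" "B \<in> sets R2" and "AE y in M2. y \<in> A \<longleftrightarrow> y \<in> B"
  shows "eq_mod_null (ratio_measure M2 (U ` F)) A B"
  unfolding eq_mod_null_def ratio_measure_def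
  by (rule AE_restr_to_subalg2[OF subalgebra_R2 assms(3)]) measurable

lemma set_map_null_iff:
  assumes A: "A \<in> sets R1"
  shows "emeasure M2 (set_map A) = 0 \<longleftrightarrow> emeasure M1 A = 0"
proof -
  note [measurable] = set_rep(1)[OF A]
  have "emeasure M2 (set_map A) = 0 \<longleftrightarrow> (AE y in M2. y \<notin> set_map A)"
    using R2_D[OF set_map_in_R2[OF A]]
    by (subst AE_iff_measurable[of "set_map A"]) (auto dest: sets.sets_into_space)
  also have "\<dots> \<longleftrightarrow> (AE y in M2. U f0 y \<noteq> 0 \<longrightarrow> \<Phi>2 y \<notin> set_rep A)"
    by (intro eventually_subst AE_I2) (auto simp: set_map_def)
  also have "\<dots> \<longleftrightarrow> (AE x in M1. \<Phi>1 x \<notin> set_rep A)"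
    by (subst AE_transfer) auto
  also have "\<dots> \<longleftrightarrow> (AE x in M1. x \<notin> A)"
    using set_rep_AE[OF A] by (intro eventually_subst) (auto elim: eventually_mono)
  also have "\<dots> \<longleftrightarrow> emeasure M1 A = 0"
    using R1_D[OF A] by (subst AE_iff_measurable[of A]) (auto dest: sets.sets_into_space)
  finally show ?thesis .
qed

lemma set_map_regular:
  "regular_set_isomorphism (ratio_measure M1 F) (ratio_measure M2 (U ` F)) set_map"
  unfolding regular_set_isomorphism_def sets_ratio_measure1 sets_ratio_measure2 space_ratio_measure
proof (intro conjI ballI allI impI)
  fix A assume A: "A \<in> sets R1"
  note [measurable] = set_rep(1)[OF A] A
  have sp: "space M1 \<in> sets R1" using sets.top[of R1] by simp
  show "set_map A \<in> sets R2" using A by (rule set_map_in_R2)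
  have cA: "space M1 - A \<in> sets R1" using sets.compl_sets[OF A] by simp
  have "AE y in M2. y \<in> set_map (space M1 - A) \<longleftrightarrow> U f0 y \<noteq> 0 \<and> \<Phi>2 y \<in> space P - set_rep A"
    using cA by (rule set_map_AE) (use set_rep_AE[OF A] AE_space in \<open>auto simp: ratio_map_in_space elim: eventually_elim2\<close>)
  then have "AE y in M2. y \<in> set_map (space M1 - A) \<longleftrightarrow> y \<in> set_map (space M1) - set_map A"
    using set_map_space_AE AE_space by eventually_elim (auto simp: set_map_def ratio_map_in_space)
  then show "eq_mod_null (ratio_measure M2 (U ` F)) (set_map (space M1 - A)) (set_map (space M1) - set_map A)"
    using A cA sp by (intro eq_mod_null_ratio_measure2 sets.Diff set_map_in_R2)
  show "emeasure (ratio_measure M2 (U ` F)) (set_map A) = 0 \<longleftrightarrow> emeasure (ratio_measure M1 F) A = 0"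
    unfolding ratio_measure_def emeasure_restr_to_subalg[OF subalgebra_R1 A]
      emeasure_restr_to_subalg[OF subalgebra_R2 set_map_in_R2[OF A]]
    by (rule set_map_null_iff[OF A])
next
  fix A :: "nat \<Rightarrow> 'a set" assume "range A \<subseteq> sets R1"
  then have A: "A n \<in> sets R1" for n by auto
  then have UA: "(\<Union>n. A n) \<in> sets R1" by auto
  have "AE x in M1. \<forall>n. x \<in> A n \<longleftrightarrow> \<Phi>1 x \<in> set_rep (A n)"
    using set_rep_AE[OF A] by (simp add: AE_all_countable)
  then have "AE x in M1. x \<in> (\<Union>n. A n) \<longleftrightarrow> \<Phi>1 x \<in> (\<Union>n. set_rep (A n))"
    by eventually_elim auto
  then have "AE y in M2. y \<in> set_map (\<Union>n. A n) \<longleftrightarrow> U f0 y \<noteq> 0 \<and> \<Phi>2 y \<in> (\<Union>n. set_rep (A n))"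
    using set_rep(1)[OF A] by (intro set_map_AE UA) auto
  then have "AE y in M2. y \<in> set_map (\<Union>n. A n) \<longleftrightarrow> y \<in> (\<Union>n. set_map (A n))"
    using AE_space by eventually_elim (auto simp: set_map_def)
  then show "eq_mod_null (ratio_measure M2 (U ` F)) (set_map (\<Union>n. A n)) (\<Union>n. set_map (A n))"
    using UA A by (intro eq_mod_null_ratio_measure2) (auto intro!: set_map_in_R2)
qed

text \<open>
  A set in the ratio field of \<open>U(F)\<close> has the form \<open>\<Phi>2 -` C\<close> on \<open>{U f0 \<noteq> 0}\<close>, and \<open>\<Phi>1 -` C\<close> is a preimage of it.
\<close>
lemma set_map_onto:
  assumes A: "A \<in> sets R2"
  shows "\<exists>B\<in>sets R1. eq_mod_null M2 (set_map B) (A \<inter> set_map (space M1))"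
proof -
  obtain C where C[measurable]: "C \<in> sets P" and AC: "\<forall>y\<in>space M2. U f0 y \<noteq> 0 \<longrightarrow> (y \<in> A \<longleftrightarrow> \<Phi>2 y \<in> C)"
    using ratio_field_set_factorization[OF UF_Lplus f0_in A] by blast
  let ?B = "\<Phi>1 -` C \<inter> space R1"
  have B: "?B \<in> sets R1" by measurable
  have "AE y in M2. y \<in> set_map ?B \<longleftrightarrow> U f0 y \<noteq> 0 \<and> \<Phi>2 y \<in> C"
    using B C by (rule set_map_AE) simp
  then have "AE y in M2. y \<in> set_map ?B \<longleftrightarrow> y \<in> A \<inter> set_map (space M1)"
    using set_map_space_AE AE_space by eventually_elim (use AC in auto)
  then show ?thesis using B unfolding eq_mod_null_def by blast
qed

lemma full_support_Uf0: "full_support M2 (U ` F) (U f0)"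
  unfolding full_support_def
proof (intro conjI ballI)
  show "U f0 \<in> borel_measurable M2" by measurable
  fix k assume "k \<in> U ` F"
  then obtain f where f: "f \<in> F" "k = U f" by auto
  note [measurable] = U_measurable[OF f(1)]
  have "fun_supp M2 k - fun_supp M2 (U f0) = {y \<in> space M2. U f y \<noteq> 0 \<and> U f0 y = 0}"
    by (auto simp: fun_supp_def f)
  moreover have "emeasure M2 {y \<in> space M2. U f y \<noteq> 0 \<and> U f0 y = 0} = 0"
    using U_zero_off_support[OF f(1)]
    by (subst AE_iff_measurable[symmetric, where P = "\<lambda>y. U f0 y = 0 \<longrightarrow> U f y = 0"]) auto
  ultimately show "emeasure M2 (fun_supp M2 k - fun_supp M2 (U f0)) = 0" by simp
qed

lemma set_map_is_supp: "is_supp M2 (U ` F) (set_map (space M1))"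
proof -
  have "eq_mod_null M2 (fun_supp M2 (U f0)) (set_map (space M1))"
    unfolding eq_mod_null_def using set_map_space_AE AE_space
    by eventually_elim (auto simp: fun_supp_def)
  then show ?thesis
    unfolding is_supp_def using f0_in full_support_Uf0 by blast
qed

lemma fun_map_induced:
  "induces_function_map (ratio_measure M1 F) (ratio_measure M2 (U ` F)) set_map fun_map"
  unfolding induces_function_map_def space_ratio_measure
    measurable_cong_sets[OF sets_ratio_measure1 refl] measurable_cong_sets[OF sets_ratio_measure2 refl]
proof (intro ballI conjI)
  fix r :: "'a \<Rightarrow> real" assume r: "r \<in> borel_measurable R1"
  note [measurable] = fun_rep(1)[OF r] r fun_map_measurable[OF r]
  have sp: "space M1 \<in> sets R1" using sets.top[of R1] by simp
  note [measurable] = set_map_in_R2[OF sp]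
  show "fun_map r \<in> borel_measurable R2" using r by (rule fun_map_measurable)
  show "AE y in ratio_measure M2 (U ` F). y \<notin> set_map (space M1) \<longrightarrow> fun_map r y = 0"
    unfolding ratio_measure_def
  proof (rule AE_restr_to_subalg2[OF subalgebra_R2])
    show "AE y in M2. y \<notin> set_map (space M1) \<longrightarrow> fun_map r y = 0"
      using set_map_space_AE by eventually_elim (auto simp: fun_map_def)
  qed measurable
  fix B :: "real set" assume B [measurable]: "B \<in> sets borel"
  let ?C = "fun_rep r -` B \<inter> space P"
  have rB: "r -` B \<inter> space M1 \<in> sets R1"
    using measurable_sets[OF r B] by simp
  have "AE x in M1. x \<in> r -` B \<inter> space M1 \<longleftrightarrow> \<Phi>1 x \<in> ?C"
    using fun_rep_AE[OF r] AE_space by eventually_elim (auto simp: ratio_map_in_space)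
  then have "AE y in M2. y \<in> set_map (r -` B \<inter> space M1) \<longleftrightarrow> U f0 y \<noteq> 0 \<and> \<Phi>2 y \<in> ?C"
    by (intro set_map_AE rB) measurable
  then have "AE y in M2. y \<in> fun_map r -` B \<inter> set_map (space M1) \<longleftrightarrow> y \<in> set_map (r -` B \<inter> space M1)"
    using set_map_space_AE by eventually_elim (auto simp: fun_map_def ratio_map_in_space)
  moreover have "fun_map r -` B \<inter> set_map (space M1) \<in> sets R2"
  proof -
    have "fun_map r -` B \<inter> space R2 \<inter> set_map (space M1) \<in> sets R2" by measurable
    moreover have "fun_map r -` B \<inter> space R2 \<inter> set_map (space M1) = fun_map r -` B \<inter> set_map (space M1)"
      by (auto simp: set_map_def)
    ultimately show ?thesis by simp
  qed
  ultimately show "eq_mod_null (ratio_measure M2 (U ` F)) (fun_map r -` B \<inter> set_map (space M1)) (set_map (r -` B \<inter> space M1))"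
    by (intro eq_mod_null_ratio_measure2 set_map_in_R2 rB)
qed

text \<open>
  Both sides are the integral of \<open>z \<mapsto> (z f)\<^sup>\<alpha>\<close> over a representative of \<open>B\<close> with respect to the common
  law of the ratios.
\<close>
lemma density_set_map:
  assumes f: "f \<in> F" and A: "A \<in> sets R2" and B: "B \<in> sets R1"
    and AB: "eq_mod_null M2 (set_map B) (A \<inter> set_map (space M1))"
  shows "emeasure (density M2 (\<lambda>y. ennreal (U f y powr \<alpha>))) A = emeasure (density M1 (\<lambda>x. ennreal (f x powr \<alpha>))) B"
proof -
  note [measurable] = F_measurable[OF f] U_measurable[OF f] f set_rep(1)[OF B] R1_D[OF B] R2_D[OF A]
  let ?g = "\<lambda>z. indicator (set_rep B) z * ennreal (z f powr \<alpha>)"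
  have "emeasure (density M2 (\<lambda>y. ennreal (U f y powr \<alpha>))) A = (\<integral>\<^sup>+ y. ennreal (U f y powr \<alpha>) * indicator A y \<partial>M2)"
    by (rule emeasure_density) measurable
  also have "\<dots> = (\<integral>\<^sup>+ y. ?g (\<Phi>2 y) * ennreal (U f0 y powr \<alpha>) \<partial>M2)"
    using U_zero_off_support[OF f] AB[unfolded eq_mod_null_def] set_map_space_AE AE_space[of M2]
  proof (intro nn_integral_cong_AE, eventually_elim)
    case (elim y)
    show ?case
    proof (cases "U f0 y = 0")
      case True
      then show ?thesis using elim by simp
    next
      case False
      then have "y \<in> A \<longleftrightarrow> \<Phi>2 y \<in> set_rep B"
        using elim by (auto simp: set_map_def)
      moreover have "ennreal ((U f y / U f0 y) powr \<alpha>) * ennreal (U f0 y powr \<alpha>) = ennreal (U f y powr \<alpha>)"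
        using False elim f f0_in U_nonneg by (intro ratio_powr) auto
      ultimately show ?thesis
        using f by (auto simp: indicator_def)
    qed
  qed
  also have "\<dots> = (\<integral>\<^sup>+ x. ?g (\<Phi>1 x) * ennreal (f0 x powr \<alpha>) \<partial>M1)"
    by (rule nn_integral_transfer[symmetric]) measurable
  also have "\<dots> = (\<integral>\<^sup>+ x. ennreal (f x powr \<alpha>) * indicator B x \<partial>M1)"
    using f0_nonzero set_rep_AE[OF B] AE_space[of M1]
  proof (intro nn_integral_cong_AE, eventually_elim)
    case (elim x)
    moreover have "ennreal ((f x / f0 x) powr \<alpha>) * ennreal (f0 x powr \<alpha>) = ennreal (f x powr \<alpha>)"
      using elim f f0_in F_nonneg by (intro ratio_powr) auto
    ultimately show ?case
      using f by (auto simp: indicator_def)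
  qed
  also have "\<dots> = emeasure (density M1 (\<lambda>x. ennreal (f x powr \<alpha>))) B"
    by (rule emeasure_density[symmetric]) measurable
  finally show ?thesis .
qed


section \<open>The extended isometry\<close>

text \<open>
  Every \<open>h = r f\<close> in the extended ratio space is also \<open>(h / f0) f0\<close> almost everywhere, and
  \<open>h / f0 = r (f / f0)\<close> is again measurable for the ratio field. Going through the fixed \<open>f0\<close> avoids having to
  check that \<open>Tr \<cdot> U f\<close> does not depend on how \<open>h\<close> is written.
\<close>
definition extension :: "('a \<Rightarrow> real) \<Rightarrow> 'b \<Rightarrow> real" where
  "extension h y = fun_map (\<lambda>x. h x / f0 x) y * U f0 y"

abbreviation "E1 \<equiv> extended_positive_ratio_space \<alpha> M1 F"
abbreviation "E2 \<equiv> extended_positive_ratio_space \<alpha> M2 (U ` F)"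

text \<open>
  The main tool of this section: \<open>(g \<circ> \<Phi>1) f0\<close> is mapped to \<open>(g \<circ> \<Phi>2) U f0\<close> for every measurable \<open>g\<close>,
  so identities between extensions reduce to identities between functions on the product space.
\<close>
lemma extension_AE:
  assumes r: "(\<lambda>x. h x / f0 x) \<in> borel_measurable R1" and g: "g \<in> borel_measurable P"
    and hg: "AE x in M1. h x = g (\<Phi>1 x) * f0 x"
  shows "AE y in M2. extension h y = g (\<Phi>2 y) * U f0 y"
proof -
  have "AE x in M1. h x / f0 x = g (\<Phi>1 x)"
    using hg f0_nonzero by eventually_elim simp
  from fun_map_AE[OF r g this] show ?thesis
    by eventually_elim (simp add: extension_def)
qed

lemma E1_ratio:
  assumes "h \<in> E1"
  shows "(\<lambda>x. h x / f0 x) \<in> ratio_functions M1 F"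
proof -
  obtain r f where h: "h \<in> Lplus \<alpha> M1" and r: "r \<in> ratio_functions M1 F" and f: "f \<in> F"
    and eq: "\<forall>x\<in>space M1. h x = r x * f x"
    using assms unfolding extended_positive_ratio_space_def by blast
  note [measurable] = ratio_R1[OF f f0_in]
  have [measurable]: "r \<in> borel_measurable R1" using r by (simp add: ratio_functions_def)
  have "(\<lambda>x. r x * (f x / f0 x)) \<in> borel_measurable R1" by measurable
  moreover have "h x / f0 x = r x * (f x / f0 x)" if "x \<in> space R1" for x
    using that eq by simp
  ultimately have "(\<lambda>x. h x / f0 x) \<in> borel_measurable R1"
    by (rule measurable_cong[THEN iffD2, rotated])
  moreover have "0 \<le> h x / f0 x" if "x \<in> space M1" for x
    using that LplusD(2)[OF h] F_nonneg[OF f0_in] by simp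
  ultimately show ?thesis by (simp add: ratio_functions_def)
qed

lemma E1_Lplus: "h \<in> E1 \<Longrightarrow> h \<in> Lplus \<alpha> M1"
  by (simp add: extended_positive_ratio_space_def)

lemma E1_rep:
  assumes "h \<in> E1"
  obtains g where "g \<in> borel_measurable P" "\<And>z. 0 \<le> g z"
    "AE x in M1. h x = g (\<Phi>1 x) * f0 x" "AE y in M2. extension h y = g (\<Phi>2 y) * U f0 y"
proof -
  have r: "(\<lambda>x. h x / f0 x) \<in> borel_measurable R1" and nn: "\<And>x. x \<in> space M1 \<Longrightarrow> 0 \<le> h x / f0 x"
    using E1_ratio[OF assms] by (auto simp: ratio_functions_def)
  have h: "AE x in M1. h x = fun_rep (\<lambda>x. h x / f0 x) (\<Phi>1 x) * f0 x"
    using fun_rep_AE[OF r] f0_nonzero by eventually_elim (simp add: field_simps)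
  show ?thesis
    using that[OF fun_rep(1)[OF r] fun_rep(3)[OF r nn] h extension_AE[OF r fun_rep(1)[OF r] h]] by simp
qed

lemma E2_rep:
  assumes "k \<in> E2"
  obtains g where "g \<in> borel_measurable P" "\<And>z. 0 \<le> g z" "AE y in M2. k y = g (\<Phi>2 y) * U f0 y"
proof -
  obtain r f where k: "k \<in> Lplus \<alpha> M2" and r: "r \<in> ratio_functions M2 (U ` F)" and f: "f \<in> F"
    and eq: "\<forall>y\<in>space M2. k y = r y * U f y"
    using assms unfolding extended_positive_ratio_space_def by blast
  note [measurable] = ratio_R2[OF f f0_in]
  have [measurable]: "r \<in> borel_measurable R2" and nn: "\<And>y. y \<in> space M2 \<Longrightarrow> 0 \<le> r y"
    using r by (auto simp: ratio_functions_def)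
  have "(\<lambda>y. r y * (U f y / U f0 y)) \<in> borel_measurable R2" by measurable
  from ratio_field_function_factorization[OF UF_Lplus f0_in this]
  obtain g where g: "g \<in> borel_measurable P"
    "\<forall>y\<in>space M2. U f0 y \<noteq> 0 \<longrightarrow> r y * (U f y / U f0 y) = g (\<Phi>2 y)"
    "(\<forall>y\<in>space M2. 0 \<le> r y * (U f y / U f0 y)) \<longrightarrow> (\<forall>z. 0 \<le> g z)"
    by blast
  have "AE y in M2. k y = g (\<Phi>2 y) * U f0 y"
    using U_zero_off_support[OF f] AE_space
  proof eventually_elim
    case (elim y)
    then show ?case
      using eq g(2) by (cases "U f0 y = 0") (auto simp: field_simps)
  qed
  moreover have "0 \<le> r y * (U f y / U f0 y)" if "y \<in> space M2" for y
    using that nn U_nonneg f f0_in by simp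
  ultimately show ?thesis
    using that g by blast
qed

lemma nn_integral_rep_transfer:
  assumes [measurable]: "g \<in> borel_measurable P" and g: "\<And>z. 0 \<le> g z"
    and h: "AE x in M1. h x = g (\<Phi>1 x) * f0 x" and k: "AE y in M2. k y = g (\<Phi>2 y) * U f0 y"
  shows "(\<integral>\<^sup>+ x. ennreal (h x powr \<alpha>) \<partial>M1) = (\<integral>\<^sup>+ y. ennreal (k y powr \<alpha>) \<partial>M2)"
proof -
  have "(\<integral>\<^sup>+ x. ennreal (h x powr \<alpha>) \<partial>M1) = (\<integral>\<^sup>+ x. ennreal (g (\<Phi>1 x) powr \<alpha>) * ennreal (f0 x powr \<alpha>) \<partial>M1)"
    using h AE_space[of M1]
    by (intro nn_integral_cong_AE, eventually_elim)
       (use g F_nonneg[OF f0_in] in \<open>simp add: powr_mult ennreal_mult\<close>)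
  also have "\<dots> = (\<integral>\<^sup>+ y. ennreal (g (\<Phi>2 y) powr \<alpha>) * ennreal (U f0 y powr \<alpha>) \<partial>M2)"
    by (rule nn_integral_transfer) measurable
  also have "\<dots> = (\<integral>\<^sup>+ y. ennreal (k y powr \<alpha>) \<partial>M2)"
    using k AE_space[of M2]
    by (intro nn_integral_cong_AE, eventually_elim)
       (use g U_nonneg[OF f0_in] in \<open>simp add: powr_mult ennreal_mult\<close>)
  finally show ?thesis .
qed

lemma extension_nn_integral:
  assumes "h \<in> E1"
  shows "(\<integral>\<^sup>+ y. ennreal (extension h y powr \<alpha>) \<partial>M2) = (\<integral>\<^sup>+ x. ennreal (h x powr \<alpha>) \<partial>M1)"
proof -
  obtain g where "g \<in> borel_measurable P" "\<And>z. 0 \<le> g z"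
    "AE x in M1. h x = g (\<Phi>1 x) * f0 x" "AE y in M2. extension h y = g (\<Phi>2 y) * U f0 y"
    by (rule E1_rep[OF assms]) blast
  from nn_integral_rep_transfer[OF this] show ?thesis by simp
qed

lemma extension_in_E2:
  assumes "h \<in> E1"
  shows "extension h \<in> E2"
proof -
  have t: "fun_map (\<lambda>x. h x / f0 x) \<in> ratio_functions M2 (U ` F)"
    using fun_map_ratio_functions[OF E1_ratio[OF assms]] .
  then have [measurable]: "fun_map (\<lambda>x. h x / f0 x) \<in> borel_measurable M2"
    using measurable_from_subalg[OF subalgebra_R2] by (auto simp: ratio_functions_def)
  have "extension h \<in> borel_measurable M2"
    unfolding extension_def by measurable
  moreover have "0 \<le> extension h y" if "y \<in> space M2" for y
    using t that U_nonneg[OF f0_in] by (simp add: extension_def ratio_functions_def)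
  ultimately have "extension h \<in> Lplus \<alpha> M2"
    using extension_nn_integral[OF assms] LplusD(3)[OF E1_Lplus[OF assms]] by (simp add: Lplus_def)
  then show ?thesis
    using t f0_in by (auto simp: extended_positive_ratio_space_def extension_def)
qed

lemma extension_max:
  assumes h: "h \<in> E1" and k: "k \<in> E1" and ab: "0 \<le> a" "0 \<le> b"
  shows "AE y in M2. extension (\<lambda>x. max (a * h x) (b * k x)) y = max (a * extension h y) (b * extension k y)"
proof -
  obtain g where g [measurable]: "g \<in> borel_measurable P" and "\<And>z. 0 \<le> g z" and
    gh: "AE x in M1. h x = g (\<Phi>1 x) * f0 x" "AE y in M2. extension h y = g (\<Phi>2 y) * U f0 y"
    by (rule E1_rep[OF h]) blast
  obtain l where l [measurable]: "l \<in> borel_measurable P" and "\<And>z. 0 \<le> l z" and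
    lk: "AE x in M1. k x = l (\<Phi>1 x) * f0 x" "AE y in M2. extension k y = l (\<Phi>2 y) * U f0 y"
    by (rule E1_rep[OF k]) blast
  have mm: "max (a * (s * t)) (b * (u * t)) = max (a * s) (b * u) * t" if "0 \<le> t" for s t u :: real
    using that by (simp only: max_mult_distrib_right mult.assoc if_True)
  have [measurable]: "(\<lambda>x. h x / f0 x) \<in> borel_measurable R1" "(\<lambda>x. k x / f0 x) \<in> borel_measurable R1"
    using E1_ratio[OF h] E1_ratio[OF k] by (auto simp: ratio_functions_def)
  have "(\<lambda>x. max (a * (h x / f0 x)) (b * (k x / f0 x))) \<in> borel_measurable R1" by measurable
  moreover have "max (a * h x) (b * k x) / f0 x = max (a * (h x / f0 x)) (b * (k x / f0 x))"
    if "x \<in> space R1" for x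
  proof -
    have "0 \<le> inverse (f0 x)" using that F_nonneg[OF f0_in, of x] by simp
    from mm[OF this, of "h x" "k x"] show ?thesis
      by (simp only: divide_inverse)
  qed
  ultimately have r: "(\<lambda>x. max (a * h x) (b * k x) / f0 x) \<in> borel_measurable R1"
    by (rule measurable_cong[THEN iffD2, rotated])
  have "AE x in M1. max (a * h x) (b * k x) = max (a * g (\<Phi>1 x)) (b * l (\<Phi>1 x)) * f0 x"
    using gh(1) lk(1) AE_space by eventually_elim (simp only: mm[OF F_nonneg[OF f0_in]])
  then have "AE y in M2. extension (\<lambda>x. max (a * h x) (b * k x)) y = max (a * g (\<Phi>2 y)) (b * l (\<Phi>2 y)) * U f0 y"
    by (intro extension_AE[OF r]) measurable
  then show ?thesis
    using gh(2) lk(2) AE_space by eventually_elim (simp only: mm[OF U_nonneg[OF f0_in]])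
qed

lemma extension_isometry: "max_linear_isometry \<alpha> M1 M2 E1 extension"
  unfolding max_linear_isometry_def
proof (intro conjI ballI allI impI)
  fix h assume h: "h \<in> E1"
  show L: "extension h \<in> Lplus \<alpha> M2"
    using extension_in_E2[OF h] by (simp add: extended_positive_ratio_space_def)
  show "Lplus_norm \<alpha> M2 (extension h) = Lplus_norm \<alpha> M1 h"
    using Lplus_norm_eq_iff[OF \<alpha>_pos L E1_Lplus[OF h]] extension_nn_integral[OF h] by simp
qed (rule extension_max)

lemma extension_ratio_mult:
  assumes r: "r \<in> ratio_functions M1 F" and f: "f \<in> F"
  shows "AE y in M2. extension (\<lambda>x. r x * f x) y = fun_map r y * U f y"
proof -
  have rm [measurable]: "r \<in> borel_measurable R1" using r by (simp add: ratio_functions_def)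
  note [measurable] = fun_rep(1)[OF rm] ratio_R1[OF f f0_in] f
  have "(\<lambda>x. r x * (f x / f0 x)) \<in> borel_measurable R1" by measurable
  then have m: "(\<lambda>x. r x * f x / f0 x) \<in> borel_measurable R1" by simp
  have "AE x in M1. r x * f x = fun_rep r (\<Phi>1 x) * \<Phi>1 x f * f0 x"
    using fun_rep_AE[OF rm] f0_nonzero by eventually_elim (simp add: f)
  then have "AE y in M2. extension (\<lambda>x. r x * f x) y = fun_rep r (\<Phi>2 y) * \<Phi>2 y f * U f0 y"
    by (intro extension_AE[OF m]) measurable
  then show ?thesis
    using U_zero_off_support[OF f] by eventually_elim (auto simp: f fun_map_def)
qed

lemma one_ratio: "(\<lambda>_. 1) \<in> ratio_functions M1 F"
  by (simp add: ratio_functions_def)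

lemma F_subset_E1: "F \<subseteq> E1"
proof
  fix f assume f: "f \<in> F"
  then have "f \<in> Lplus \<alpha> M1" using F_Lplus by auto
  then show "f \<in> E1"
    unfolding extended_positive_ratio_space_def
    by (intro CollectI conjI bexI[OF _ one_ratio] bexI[OF _ f]) simp_all
qed

lemma extension_extends:
  assumes f: "f \<in> F"
  shows "AE y in M2. extension f y = U f y"
proof -
  have 1: "(\<lambda>_. 1) \<in> borel_measurable R1" by simp
  have "AE y in M2. fun_map (\<lambda>_. 1) y = (if U f0 y = 0 then 0 else 1)"
    using fun_map_AE[OF 1, of "\<lambda>_. 1"] by simp
  then show ?thesis
    using extension_ratio_mult[OF one_ratio f] U_zero_off_support[OF f] by eventually_elim auto
qed

lemma extension_onto:
  assumes k: "k \<in> E2"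
  shows "\<exists>h\<in>E1. AE y in M2. extension h y = k y"
proof -
  obtain g where g [measurable]: "g \<in> borel_measurable P" and nn: "\<And>z. 0 \<le> g z"
    and kg: "AE y in M2. k y = g (\<Phi>2 y) * U f0 y"
    by (rule E2_rep[OF k]) blast
  define h where "h = (\<lambda>x. g (\<Phi>1 x) * f0 x)"
  have "(\<integral>\<^sup>+ x. ennreal (h x powr \<alpha>) \<partial>M1) = (\<integral>\<^sup>+ y. ennreal (k y powr \<alpha>) \<partial>M2)"
    using g nn _ kg by (rule nn_integral_rep_transfer) (simp add: h_def)
  also have "\<dots> < \<infinity>"
    using k by (intro LplusD(3)) (simp add: extended_positive_ratio_space_def)
  finally have "h \<in> Lplus \<alpha> M1"
    using nn F_nonneg[OF f0_in] by (simp add: Lplus_def h_def)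
  moreover have gR: "(\<lambda>x. g (\<Phi>1 x)) \<in> ratio_functions M1 F"
    using nn by (simp add: ratio_functions_def)
  ultimately have h: "h \<in> E1"
    unfolding extended_positive_ratio_space_def
    by (intro CollectI conjI bexI[OF _ gR] bexI[OF _ f0_in]) (simp_all add: h_def)
  have "(\<lambda>x. h x / f0 x) \<in> borel_measurable R1"
    using E1_ratio[OF h] by (simp add: ratio_functions_def)
  then have "AE y in M2. extension h y = g (\<Phi>2 y) * U f0 y"
    by (rule extension_AE[OF _ g]) (simp add: h_def)
  with kg have "AE y in M2. extension h y = k y"
    by eventually_elim simp
  with h show ?thesis by blast
qed

text \<open>
  Dividing by \<open>f0\<close> would lose the values on \<open>{f0 = 0}\<close>, but membership in the extended ratio space requires
  a product representation at every point. Dividing by \<open>m = f \<or> g\<close> instead works pointwise, because where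
  \<open>m\<close> vanishes so do both \<open>r f\<close> and \<open>s g\<close>.
\<close>
lemma E1_max:
  assumes h: "h \<in> E1" and k: "k \<in> E1" and ab: "0 \<le> a" "0 \<le> b"
  shows "(\<lambda>x. max (a * h x) (b * k x)) \<in> E1"
proof -
  obtain r f where r: "r \<in> ratio_functions M1 F" and f: "f \<in> F" and hr: "\<forall>x\<in>space M1. h x = r x * f x"
    using h unfolding extended_positive_ratio_space_def by blast
  obtain s g where s: "s \<in> ratio_functions M1 F" and g: "g \<in> F" and ks: "\<forall>x\<in>space M1. k x = s x * g x"
    using k unfolding extended_positive_ratio_space_def by blast
  \<comment> \<open>The factors \<open>1\<close> give \<open>m\<close> the shape in which closure under maxima is stated.\<close>
  define m where "m = (\<lambda>x. max (1 * f x) (1 * g x))"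
  have m: "m \<in> F" unfolding m_def using f g by (intro max_in_F) auto
  note [measurable] = ratio_R1[OF f m] ratio_R1[OF g m] LplusD(1)[OF E1_Lplus[OF h]] LplusD(1)[OF E1_Lplus[OF k]]
  have [measurable]: "r \<in> borel_measurable R1" "s \<in> borel_measurable R1"
    using r s by (auto simp: ratio_functions_def)
  define t where "t = (\<lambda>x. max (a * (r x * (f x / m x))) (b * (s x * (g x / m x))))"
  have nn: "0 \<le> f x" "0 \<le> g x" "0 \<le> r x" "0 \<le> s x" "0 \<le> m x" "0 \<le> h x" "0 \<le> k x"
    if "x \<in> space M1" for x
    using that f g r s m F_nonneg LplusD(2)[OF E1_Lplus[OF h]] LplusD(2)[OF E1_Lplus[OF k]]
    by (auto simp: ratio_functions_def)
  have "t \<in> borel_measurable R1" unfolding t_def by measurable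
  then have t: "t \<in> ratio_functions M1 F"
    using nn ab by (auto simp: ratio_functions_def t_def intro!: max.coboundedI1)
  have eq: "max (a * h x) (b * k x) = t x * m x" if x: "x \<in> space M1" for x
  proof (cases "m x = 0")
    case True
    then have "f x = 0" "g x = 0" using nn[OF x] by (auto simp: m_def max_def split: if_splits)
    then show ?thesis using True hr ks x by simp
  next
    case False
    then have "0 < m x" using nn[OF x] by simp
    then show ?thesis
      using hr ks x by (simp add: t_def max_mult_distrib_right)
  qed
  have "(\<integral>\<^sup>+ x. ennreal (max (a * h x) (b * k x) powr \<alpha>) \<partial>M1) \<le>
    (\<integral>\<^sup>+ x. ennreal (a powr \<alpha>) * ennreal (h x powr \<alpha>) + ennreal (b powr \<alpha>) * ennreal (k x powr \<alpha>) \<partial>M1)"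
  proof (rule nn_integral_mono)
    fix x assume x: "x \<in> space M1"
    have "max (a * h x) (b * k x) powr \<alpha> \<le> a powr \<alpha> * h x powr \<alpha> + b powr \<alpha> * k x powr \<alpha>"
      using nn[OF x] ab by (simp add: powr_max[OF _ _ \<alpha>_pos] powr_mult)
    then show "ennreal (max (a * h x) (b * k x) powr \<alpha>) \<le>
      ennreal (a powr \<alpha>) * ennreal (h x powr \<alpha>) + ennreal (b powr \<alpha>) * ennreal (k x powr \<alpha>)"
      by (simp add: ennreal_mult[symmetric] ennreal_plus[symmetric] del: ennreal_plus)
  qed
  also have "\<dots> < \<infinity>"
    using LplusD(3)[OF E1_Lplus[OF h]] LplusD(3)[OF E1_Lplus[OF k]]
    by (simp add: nn_integral_add nn_integral_cmult ennreal_mult_less_top)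
  finally have "(\<lambda>x. max (a * h x) (b * k x)) \<in> Lplus \<alpha> M1"
    using nn ab by (auto simp: Lplus_def intro!: max.coboundedI1)
  then show ?thesis
    unfolding extended_positive_ratio_space_def using t m eq by blast
qed

section \<open>Uniqueness and the main result\<close>

text \<open>
  The ratios of the family \<open>V\<close> on the extended ratio space include the coordinate \<open>V h / V f0\<close> next to
  those indexed by \<open>F\<close>. The event \<open>z h = g (restrict z F)\<close> has full measure on the source side, hence also
  on the target side.
\<close>
lemma extension_unique:
  assumes V: "max_linear_isometry \<alpha> M1 M2 E1 V" and VU: "\<And>f. f \<in> F \<Longrightarrow> AE y in M2. V f y = U f y"
    and h: "h \<in> E1"
  shows "AE y in M2. V h y = extension h y"
proof -
  \<comment> \<open>Agreement almost everywhere for each single \<open>f\<close> does not give agreement of the two ratio maps at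
    almost every point when \<open>F\<close> is uncountable; after this modification they agree at every point.\<close>
  define W where "W k = (if k \<in> F then U k else V k)" for k
  have VW: "AE y in M2. V k y = W k y" for k
    using VU[of k] by (cases "k \<in> F") (simp_all add: W_def)
  have WL: "W k \<in> Lplus \<alpha> M2" if "k \<in> E1" for k
    using V that U_Lplus[of k] by (simp add: W_def max_linear_isometry_def)
  have "max_linear_isometry \<alpha> M1 M2 E1 W"
    by (rule max_linear_isometry_cong_AE[OF V VW WL E1_max])
  then interpret E: max_isometry_frame \<alpha> M1 M2 E1 W f0
    using F_subset_E1 f0_in E1_max f0_nonzero \<alpha>_pos E1_Lplus by unfold_locales auto
  obtain g where g: "g \<in> borel_measurable P" and "\<And>z. 0 \<le> g z" and
    gh: "AE x in M1. h x = g (\<Phi>1 x) * f0 x" "AE y in M2. extension h y = g (\<Phi>2 y) * U f0 y"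
    by (rule E1_rep[OF h]) blast
  have "(\<lambda>z. restrict z F) \<in> measurable E.P P"
    by (rule measurable_restrict_subset[OF F_subset_E1])
  then have "(\<lambda>z. g (restrict z F)) \<in> borel_measurable E.P"
    using g by (rule measurable_compose)
  moreover have "(\<lambda>z. z h) \<in> borel_measurable E.P"
    by (rule measurable_component_singleton[OF h])
  ultimately have Q: "Measurable.pred E.P (\<lambda>z. z h = g (restrict z F))"
    unfolding pred_def by (intro borel_measurable_eq)
  have r1: "restrict (E.\<Phi>1 x) F = \<Phi>1 x" for x
    using F_subset_E1 by (auto simp: ratio_map_def restrict_def fun_eq_iff)
  have r2: "restrict (E.\<Phi>2 y) F = \<Phi>2 y" for y
    using F_subset_E1 f0_in by (auto simp: ratio_map_def restrict_def fun_eq_iff W_def)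
  have "AE x in M1. E.\<Phi>1 x h = g (restrict (E.\<Phi>1 x) F)"
    using gh(1) f0_nonzero by eventually_elim (simp add: r1 h)
  then have "AE y in M2. W f0 y \<noteq> 0 \<longrightarrow> E.\<Phi>2 y h = g (restrict (E.\<Phi>2 y) F)"
    using E.AE_transfer[OF Q] by simp
  then have "AE y in M2. U f0 y \<noteq> 0 \<longrightarrow> W h y / U f0 y = g (\<Phi>2 y)"
    using f0_in h by (simp add: r2) (simp add: W_def)
  moreover have "AE y in M2. U f0 y = 0 \<longrightarrow> W h y = 0"
    using E.U_zero_off_support[OF h] f0_in by (simp add: W_def)
  \<comment> \<open>Where \<open>U f0\<close> vanishes both sides are zero.\<close>
  ultimately show ?thesis
    using gh(2) VW[of h] by eventually_elim (auto simp: field_simps)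
qed

end

theorem theorem3p2:
  fixes M1 :: "'a measure" and M2 :: "'b measure" and \<alpha> :: real
    and F :: "('a \<Rightarrow> real) set" and U :: "('a \<Rightarrow> real) \<Rightarrow> 'b \<Rightarrow> real"
  assumes "\<alpha> > 0"
    and "max_linear_subspace \<alpha> M1 F"
    and "is_supp M1 F (space M1)"
    and "sigma_finite_measure M1"
    and "max_linear_isometry \<alpha> M1 M2 F U"
  shows "\<exists>Ubar.
    max_linear_isometry \<alpha> M1 M2 (extended_positive_ratio_space \<alpha> M1 F) Ubar \<and>
    (\<forall>f\<in>F. AE x in M2. Ubar f x = U f x) \<and>
    (\<forall>V. max_linear_isometry \<alpha> M1 M2 (extended_positive_ratio_space \<alpha> M1 F) V \<and>
         (\<forall>f\<in>F. AE x in M2. V f x = U f x) \<longrightarrow>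
         (\<forall>h\<in>extended_positive_ratio_space \<alpha> M1 F. AE x in M2. V h x = Ubar h x)) \<and>
    (\<forall>h\<in>extended_positive_ratio_space \<alpha> M1 F.
       \<exists>k\<in>extended_positive_ratio_space \<alpha> M2 (U ` F). AE x in M2. Ubar h x = k x) \<and>
    (\<forall>k\<in>extended_positive_ratio_space \<alpha> M2 (U ` F).
       \<exists>h\<in>extended_positive_ratio_space \<alpha> M1 F. AE x in M2. Ubar h x = k x) \<and>
    (\<exists>T Tf.
       regular_set_isomorphism (ratio_measure M1 F) (ratio_measure M2 (U ` F)) T \<and>
       is_supp M2 (U ` F) (T (space M1)) \<and>
       (\<forall>A\<in>sets (ratio_field M2 (U ` F)). \<exists>B\<in>sets (ratio_field M1 F).
          eq_mod_null M2 (T B) (A \<inter> T (space M1))) \<and>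
       induces_function_map (ratio_measure M1 F) (ratio_measure M2 (U ` F)) T Tf \<and>
       (\<forall>r\<in>ratio_functions M1 F. Tf r \<in> ratio_functions M2 (U ` F)) \<and>
       (\<forall>r\<in>ratio_functions M1 F. \<forall>f\<in>F. (\<lambda>x. r x * f x) \<in> Lplus \<alpha> M1 \<longrightarrow>
          (AE x in M2. Ubar (\<lambda>x. r x * f x) x = Tf r x * U f x)) \<and>
       (\<forall>f\<in>F. \<forall>A\<in>sets (ratio_field M2 (U ` F)). \<forall>B\<in>sets (ratio_field M1 F).
          eq_mod_null M2 (T B) (A \<inter> T (space M1)) \<longrightarrow>
          emeasure (density M2 (\<lambda>x. ennreal (U f x powr \<alpha>))) A =
          emeasure (density M1 (\<lambda>x. ennreal (f x powr \<alpha>))) B))"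
proof -
  obtain f0 where f0: "f0 \<in> F" "eq_mod_null M1 (fun_supp M1 f0) (space M1)"
    using assms(3) unfolding is_supp_def by blast
  have "AE x in M1. f0 x \<noteq> 0"
    using f0(2)[unfolded eq_mod_null_def] AE_space by eventually_elim (auto simp: fun_supp_def)
  then interpret max_isometry_frame \<alpha> M1 M2 F U f0
    using assms(1,2,5) f0(1) unfolding max_linear_subspace_def by unfold_locales blast+
  show ?thesis
  proof (rule exI[of _ extension], intro conjI exI[of _ set_map] exI[of _ fun_map])
    show "max_linear_isometry \<alpha> M1 M2 E1 extension" by (rule extension_isometry)
    show "\<forall>f\<in>F. AE x in M2. extension f x = U f x" using extension_extends by blast
    show "\<forall>V. max_linear_isometry \<alpha> M1 M2 E1 V \<and> (\<forall>f\<in>F. AE x in M2. V f x = U f x) \<longrightarrow>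
        (\<forall>h\<in>E1. AE x in M2. V h x = extension h x)"
      using extension_unique by blast
    show "\<forall>h\<in>E1. \<exists>k\<in>E2. AE x in M2. extension h x = k x"
    proof
      fix h assume "h \<in> E1"
      then show "\<exists>k\<in>E2. AE x in M2. extension h x = k x"
        by (intro bexI[of _ "extension h"] AE_I2 refl extension_in_E2)
    qed
    show "\<forall>k\<in>E2. \<exists>h\<in>E1. AE x in M2. extension h x = k x" using extension_onto by blast
    show "regular_set_isomorphism (ratio_measure M1 F) (ratio_measure M2 (U ` F)) set_map"
      by (rule set_map_regular)
    show "is_supp M2 (U ` F) (set_map (space M1))" by (rule set_map_is_supp)
    show "\<forall>A\<in>sets R2. \<exists>B\<in>sets R1. eq_mod_null M2 (set_map B) (A \<inter> set_map (space M1))"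
      using set_map_onto by blast
    show "induces_function_map (ratio_measure M1 F) (ratio_measure M2 (U ` F)) set_map fun_map"
      by (rule fun_map_induced)
    show "\<forall>r\<in>ratio_functions M1 F. fun_map r \<in> ratio_functions M2 (U ` F)"
      using fun_map_ratio_functions by blast
    show "\<forall>r\<in>ratio_functions M1 F. \<forall>f\<in>F. (\<lambda>x. r x * f x) \<in> Lplus \<alpha> M1 \<longrightarrow>
        (AE x in M2. extension (\<lambda>x. r x * f x) x = fun_map r x * U f x)"
      using extension_ratio_mult by blast
    show "\<forall>f\<in>F. \<forall>A\<in>sets R2. \<forall>B\<in>sets R1. eq_mod_null M2 (set_map B) (A \<inter> set_map (space M1)) \<longrightarrow>
        emeasure (density M2 (\<lambda>x. ennreal (U f x powr \<alpha>))) A = emeasure (density M1 (\<lambda>x. ennreal (f x powr \<alpha>))) B"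
      using density_set_map by blast
  qed
qed

end
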